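(* Let $n\ge1$, let $\mathfrak p_0\in A=\mathbb F_q[T]$ be monic irreducible of degree $r$ with $\gcd(n,r)=1$, let $t\in\mathbb F_{q^r}$ be a root of $\mathfrak p_0$, let $\phi$ be the Drinfeld module with $\phi_T=t+\tau^n$, let $\mathfrak p\neq\mathfrak p_0$ be a monic irreducible element of $A$, and let $m\mid n$. Put $\kappa=A/\mathfrak p$, $M=\phi[\mathfrak p]$, $E=\operatorname{End}_\kappa(M)$, $\pi=\tau^r$, $R_0=\kappa[\pi^m|_M]$, $R=\operatorname{Cent}_E(R_0)$. For a left ideal $C\subseteq R$ and an $R_0$-submodule $W\subseteq M$ set $$Z(C)=\{v\in M:\ f(v)=0\ \text{for all } f\in C\},\qquad \operatorname{Ann}(W)=\{f\in R:\ f(W)=0\}.$$ Then $C\mapsto Z(C)$ and $W\mapsto\operatorname{Ann}(W)$ are mutually inverse bijections between the set of left ideals of $R$ and the set of $R_0$-submodules of $M$.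
   Context: $q$ is a prime power, $A=\mathbb F_q[T]$, $\overline{\mathbb F}_q$ a fixed algebraic closure, $[i]=q^i$, $\beta^{[i]}=\beta^{q^i}$. Twisted polynomials in $\tau$ satisfy $\tau a=a^q\tau$ and act on $\overline{\mathbb F}_q$ with $\tau$ acting as $x\mapsto x^q$ and constants by multiplication. The Drinfeld module $\phi$ is the $\mathbb F_q$-algebra homomorphism $A\to\mathbb F_{q^r}\{\tau\}$, $a\mapsto\phi_a$, with $\phi_T=t+\tau^n$. Its $\mathfrak p$-torsion is $M=\phi[\mathfrak p]=\{v\in\overline{\mathbb F}_q:\phi_{\mathfrak p}(v)=0\}$, a $\kappa$-vector space of dimension $n$ via $a\cdot v=\phi_a(v)$. The element $\pi=\tau^r$ acts on $M$ as the $\kappa$-linear operator $v\mapsto v^{[r]}$. $\operatorname{Cent}_E(R_0)$ denotes the centralizer of $R_0$ in $E$. *)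

theory Defs
  imports "HOL-Algebra.Algebra" "HOL-Algebra.Algebraic_Closure_Type"
    "HOL-Library.Cardinality"
begin

text \<open>
  The ground field \<open>F_q\<close> is a type of class \<open>finite_field\<close>, with \<open>q = CARD('k)\<close>; its algebraic
  closure is \<open>'k alg_closure\<close>, with inclusion \<open>to_ac\<close>; and \<open>A = F_q[T]\<close> is \<open>'k poly\<close>.
\<close>

definition Fq_ext :: "nat \<Rightarrow> 'k::finite_field alg_closure set"
  where "Fq_ext r = {x. x ^ (CARD('k) ^ r) = x}"


section \<open>Twisted polynomials\<close>

text \<open>
  The twisted polynomial \<open>\<Sum> c\<^sub>i \<tau>\<^sup>i\<close> is stored as the polynomial with coefficients \<open>c\<^sub>i\<close>. Only its
  additive structure is that of \<open>'k alg_closure poly\<close>; products are given by \<open>\<tau> a = a\<^sup>q \<tau>\<close>,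
  that is, \<open>(a \<tau>\<^sup>i) (b \<tau>\<^sup>j) = a b^(q^i) \<tau>^(i+j)\<close>.
\<close>

definition twisted_mult ::
    "'k::finite_field alg_closure poly \<Rightarrow> 'k alg_closure poly \<Rightarrow> 'k alg_closure poly"
  where "twisted_mult f g =
    (\<Sum>i\<le>Polynomial.degree f. \<Sum>j\<le>Polynomial.degree g.
       Polynomial.monom (Polynomial.coeff f i * Polynomial.coeff g j ^ (CARD('k) ^ i)) (i + j))"

text \<open>The ring \<open>F_{q^r}{\<tau>}\<close>:\<close>

definition twisted_ring :: "nat \<Rightarrow> 'k::finite_field alg_closure poly ring"
  where "twisted_ring r =
    \<lparr>carrier = {f. \<forall>i. Polynomial.coeff f i \<in> Fq_ext r}, monoid.mult = twisted_mult, one = 1,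
     ring.zero = 0, add = (+)\<rparr>"

definition twisted_apply ::
    "'k::finite_field alg_closure poly \<Rightarrow> 'k alg_closure \<Rightarrow> 'k alg_closure"
  where "twisted_apply f x = (\<Sum>i\<le>Polynomial.degree f. Polynomial.coeff f i * x ^ (CARD('k) ^ i))"

text \<open>\<open>F_q\<close>-algebra homomorphisms \<open>A \<rightarrow> F_{q^r}{\<tau>}\<close>:\<close>

definition Fq_algebra_hom ::
    "nat \<Rightarrow> ('k::finite_field poly \<Rightarrow> 'k alg_closure poly) \<Rightarrow> bool"
  where "Fq_algebra_hom r \<phi> \<longleftrightarrow>
    \<phi> \<in> ring_hom ring_of_type_algebra (twisted_ring r) \<and> (\<forall>c. \<phi> [:c:] = [:to_ac c:])"


section \<open>Torsion of a Drinfeld module\<close>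

definition torsion ::
    "('k::finite_field poly \<Rightarrow> 'k alg_closure poly) \<Rightarrow> 'k poly \<Rightarrow> 'k alg_closure set"
  where "torsion \<phi> a = {v. twisted_apply (\<phi> a) v = 0}"

definition residue_field :: "'k::finite_field poly \<Rightarrow> 'k poly set ring"
  where "residue_field \<pp> = ring_of_type_algebra Quot (PIdl\<^bsub>ring_of_type_algebra\<^esub> \<pp>)"

text \<open>
  The \<open>A/\<pp>\<close>-module \<open>\<phi>[\<pp>]\<close>. A class \<open>Q\<close> in \<open>A/\<pp>\<close> acts by \<open>v \<mapsto> \<phi>\<^sub>a(v)\<close> for any representative
  \<open>a \<in> Q\<close>; the result does not depend on \<open>a\<close> because \<open>\<phi>\<^sub>\<pp>(v) = 0\<close>. The multiplicative fields of
  a module record play no role.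
\<close>

definition torsion_module ::
    "('k::finite_field poly \<Rightarrow> 'k alg_closure poly) \<Rightarrow> 'k poly \<Rightarrow>
     ('k poly set, 'k alg_closure) module"
  where "torsion_module \<phi> \<pp> =
    \<lparr>carrier = torsion \<phi> \<pp>, monoid.mult = undefined, one = undefined,
     ring.zero = 0, add = (+),
     module.smult = (\<lambda>Q v. the_elem ((\<lambda>a. twisted_apply (\<phi> a) v) ` Q))\<rparr>"


section \<open>Endomorphism rings, centralizers and left ideals\<close>

text \<open>Endomorphisms are made extensional so that they are determined by their values on \<open>M\<close>.\<close>

definition End_ring :: "('a, 'c) ring_scheme \<Rightarrow> ('a, 'b, 'd) module_scheme \<Rightarrow> ('b \<Rightarrow> 'b) ring"
  where "End_ring K M =
    \<lparr>carrier = {f \<in> carrier M \<rightarrow>\<^sub>E carrier M.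
        (\<forall>x\<in>carrier M. \<forall>y\<in>carrier M. f (x \<oplus>\<^bsub>M\<^esub> y) = f x \<oplus>\<^bsub>M\<^esub> f y) \<and>
        (\<forall>a\<in>carrier K. \<forall>x\<in>carrier M. f (a \<odot>\<^bsub>M\<^esub> x) = a \<odot>\<^bsub>M\<^esub> f x)},
     monoid.mult = compose (carrier M), one = (\<lambda>x\<in>carrier M. x),
     ring.zero = (\<lambda>x\<in>carrier M. \<zero>\<^bsub>M\<^esub>), add = (\<lambda>f g. \<lambda>x\<in>carrier M. f x \<oplus>\<^bsub>M\<^esub> g x)\<rparr>"

definition scalar_ops :: "('a, 'c) ring_scheme \<Rightarrow> ('a, 'b, 'd) module_scheme \<Rightarrow> ('b \<Rightarrow> 'b) set"
  where "scalar_ops K M = (\<lambda>a. \<lambda>x\<in>carrier M. a \<odot>\<^bsub>M\<^esub> x) ` carrier K"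

text \<open>The subring \<open>K[f]\<close> of \<open>End\<^sub>K(M)\<close>:\<close>

definition adjoin_op ::
    "('a, 'c) ring_scheme \<Rightarrow> ('a, 'b, 'd) module_scheme \<Rightarrow> ('b \<Rightarrow> 'b) \<Rightarrow> ('b \<Rightarrow> 'b) ring"
  where "adjoin_op K M f =
    (End_ring K M)\<lparr>carrier := generate_ring (End_ring K M) (insert f (scalar_ops K M))\<rparr>"

definition centralizer :: "('a, 'b) ring_scheme \<Rightarrow> 'a set \<Rightarrow> ('a, 'b) ring_scheme"
  where "centralizer E S =
    E\<lparr>carrier := {f \<in> carrier E. \<forall>g\<in>S. f \<otimes>\<^bsub>E\<^esub> g = g \<otimes>\<^bsub>E\<^esub> f}\<rparr>"

definition left_ideal :: "'a set \<Rightarrow> ('a, 'b) ring_scheme \<Rightarrow> bool"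
  where "left_ideal I R \<longleftrightarrow>
    additive_subgroup I R \<and> (\<forall>f\<in>carrier R. \<forall>g\<in>I. f \<otimes>\<^bsub>R\<^esub> g \<in> I)"

text \<open>The underlying abelian group of \<open>M\<close>, with operators on \<open>M\<close> acting by evaluation:\<close>

definition evaluation_module :: "('a, 'b, 'd) module_scheme \<Rightarrow> ('b \<Rightarrow> 'b, 'b) module"
  where "evaluation_module M =
    \<lparr>carrier = carrier M, monoid.mult = monoid.mult M, one = one M,
     ring.zero = ring.zero M, add = add M, module.smult = (\<lambda>f. f)\<rparr>"

definition zero_locus :: "('a, 'b, 'd) module_scheme \<Rightarrow> ('b \<Rightarrow> 'b) set \<Rightarrow> 'b set"
  where "zero_locus M C = {v \<in> carrier M. \<forall>f\<in>C. f v = \<zero>\<^bsub>M\<^esub>}"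

definition annihilator ::
    "('b \<Rightarrow> 'b, 'c) ring_scheme \<Rightarrow> ('a, 'b, 'd) module_scheme \<Rightarrow> 'b set \<Rightarrow> ('b \<Rightarrow> 'b) set"
  where "annihilator R M W = {f \<in> carrier R. \<forall>w\<in>W. f w = \<zero>\<^bsub>M\<^esub>}"

end

theory Submission
  imports Defs
begin

text \<open>
  Put \<open>V = \<phi>[\<pp>]\<close>, let \<open>S\<close> be \<open>\<pi>^m\<close> acting on \<open>V\<close>, and put \<open>d = n/m\<close>. Then \<open>R\<close> is the ring of
  \<open>\<kappa>\<close>-linear maps commuting with \<open>S\<close>, and \<open>R0\<close>-submodules are the \<open>S\<close>-stable \<open>\<kappa>\<close>-subspaces of \<open>V\<close>.
  For an arbitrary operator \<open>S\<close> the two correspondences may fail to be inverse to each other: one needs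
  that \<open>V\<close> is an injective \<open>R0\<close>-module, so that maps between submodules extend, and that \<open>V\<close> separates
  the points of its quotients.

  Both properties come from multiplication by the elements of \<open>F_{q^n}\<close> inside the algebraic closure.
  Every \<open>\<phi>\<^sub>a\<close> only involves powers of \<open>\<tau>\<^sup>n\<close>, so \<open>V\<close> is stable under \<open>F_{q^n}\<close> and multiplication by
  \<open>z \<in> F_{q^n}\<close> is \<open>\<kappa>\<close>-linear. In general it does not commute with \<open>S\<close>, as \<open>S z = z^(q^(rm)) S\<close>.
  Moreover \<open>\<pi>\<^sup>n = \<phi>\<^sub>\<pp>\<^sub>0\<close> (lemma \<open>action_characteristic\<close>), because \<open>\<pp>0\<close> factors as the product of the
  \<open>T - t^(q^(ni))\<close> with \<open>i < r\<close>; hence \<open>S\<^sup>d\<close> is a scalar, and the relative trace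
  \<open>h \<mapsto> \<Sum>i<d. S\<^sup>i h S\<^sup>-\<^sup>i\<close> turns every \<open>\<kappa>\<close>-linear map into an element of \<open>R\<close>. The relative trace of
  \<open>z\<close> is multiplication by \<open>\<Sum>i<d. z^(q^(rmi))\<close>. Since \<open>gcd(n,r) = 1\<close>, the exponents \<open>rmi\<close> with \<open>i < d\<close> are
  distinct modulo \<open>n\<close>, so these twists of \<open>z\<close> are linearly independent functions on \<open>F_{q^n}\<close> (lemma
  \<open>frobenius_twists_independent\<close>) and some \<open>z\<close> has trace \<open>1\<close>.

  As in Maschke's theorem, a \<open>\<kappa>\<close>-linear extension \<open>h\<close> of an \<open>R0\<close>-linear map can then be replaced by the
  relative trace of \<open>z h\<close>, which is an \<open>R0\<close>-linear extension (lemma \<open>extend_equivariant\<close>). By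
  induction over a finite set \<open>F \<subseteq> R\<close> it follows that an element of \<open>R\<close> that vanishes on the common
  zeros of \<open>F\<close> is a left combination of \<open>F\<close> (lemma \<open>equivariant_combination\<close>); this is
  \<open>Ann(Z(C)) = C\<close>. For \<open>Z(Ann(W)) = W\<close>, take \<open>v \<notin> W\<close> and a \<open>\<kappa>\<close>-linear \<open>h\<close> with \<open>h(W) = 0\<close> and
  \<open>h(v) = v\<close>; independence of the twists gives \<open>z\<close> for which the relative trace of \<open>z h\<close>, which
  still kills \<open>W\<close>, does not kill \<open>v\<close> (lemma \<open>stable_subspace_closed\<close>).
\<close>

section \<open>Linear maps on submodules\<close>

locale scalar_module = Modules.module scale
  for scale :: "'a::comm_ring_1 \<Rightarrow> 'b::ab_group_add \<Rightarrow> 'b" (infixr \<open>\<star>\<close> 75)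
begin

text \<open>
  Linearity is relative to a domain \<open>U\<close>: maps are only meaningful on a torsion submodule, and
  extension problems start from maps on a smaller submodule still.
\<close>

definition linear_on :: "'b set \<Rightarrow> 'b set \<Rightarrow> ('b \<Rightarrow> 'b) \<Rightarrow> bool"
  where "linear_on U Y h \<longleftrightarrow> (\<forall>x\<in>U. h x \<in> Y) \<and> (\<forall>x\<in>U. \<forall>y\<in>U. h (x + y) = h x + h y) \<and>
    (\<forall>a. \<forall>x\<in>U. h (a \<star> x) = a \<star> h x)"

lemma linear_onI:
  assumes "\<And>x. x \<in> U \<Longrightarrow> h x \<in> Y" "\<And>x y. x \<in> U \<Longrightarrow> y \<in> U \<Longrightarrow> h (x + y) = h x + h y"
    "\<And>a x. x \<in> U \<Longrightarrow> h (a \<star> x) = a \<star> h x"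
  shows "linear_on U Y h"
  using assms by (auto simp: linear_on_def)

lemma linear_onD:
  assumes "linear_on U Y h"
  shows "x \<in> U \<Longrightarrow> h x \<in> Y" "x \<in> U \<Longrightarrow> y \<in> U \<Longrightarrow> h (x + y) = h x + h y"
    "x \<in> U \<Longrightarrow> h (a \<star> x) = a \<star> h x"
  using assms by (auto simp: linear_on_def)

lemma linear_on_zero: "linear_on U Y h \<Longrightarrow> subspace U \<Longrightarrow> h 0 = 0"
  using linear_onD(3)[of U Y h 0 0] subspace_0[of U] by simp

lemma linear_on_minus: "linear_on U Y h \<Longrightarrow> subspace U \<Longrightarrow> x \<in> U \<Longrightarrow> h (- x) = - h x"
  using linear_onD(3)[of U Y h x "-1"] by (simp add: scale_minus_left)

lemma linear_on_diff:
  assumes "linear_on U Y h" "subspace U" "x \<in> U" "y \<in> U"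
  shows "h (x - y) = h x - h y"
  using linear_onD(2)[OF assms(1,3), of "- y"] linear_on_minus[OF assms(1,2,4)]
    subspace_neg[OF assms(2,4)] by simp

lemma linear_on_sum:
  assumes "linear_on U Y h" "subspace U" "finite I" "\<And>i. i \<in> I \<Longrightarrow> f i \<in> U"
  shows "h (\<Sum>i\<in>I. f i) = (\<Sum>i\<in>I. h (f i))"
  using assms(3,4)
proof (induction I rule: finite_induct)
  case empty
  then show ?case using linear_on_zero[OF assms(1,2)] by simp
next
  case (insert i I)
  then show ?case
    using linear_onD(2)[OF assms(1), of "f i" "sum f I"] subspace_sum[OF assms(2), of I f] by simp
qed

lemma linear_on_comp:
  "linear_on U Y f \<Longrightarrow> linear_on Y Z g \<Longrightarrow> linear_on U Z (\<lambda>x. g (f x))"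
  by (auto simp: linear_on_def)

lemma linear_on_funpow: "linear_on V V f \<Longrightarrow> linear_on V V (f ^^ i)"
  by (induction i) (auto simp: linear_on_def)

lemma linear_on_sum_of_maps:
  assumes "subspace Y" "finite I" "\<And>i. i \<in> I \<Longrightarrow> linear_on U Y (h i)"
  shows "linear_on U Y (\<lambda>x. \<Sum>i\<in>I. h i x)"
proof (rule linear_onI)
  show "(\<Sum>i\<in>I. h i x) \<in> Y" if "x \<in> U" for x
    using assms(3) that by (intro subspace_sum[OF assms(1)]) (rule linear_onD(1))
qed (use assms(3) in \<open>simp_all add: linear_on_def sum.distrib scale_sum_right\<close>)

end

section \<open>Extending linear maps over a simple quotient of the scalars\<close>

text \<open>
  The last condition says that the scalars act on a nonzero \<open>V\<close> through a field. It is formulated in terms of the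
  ring \<open>A\<close> itself, so that a residue field of \<open>A\<close> does not have to be made into a type.
\<close>

locale simple_torsion_module = scalar_module scale
  for scale :: "'a::comm_ring_1 \<Rightarrow> 'b::ab_group_add \<Rightarrow> 'b" (infixr \<open>\<star>\<close> 75) +
  fixes V :: "'b set"
  assumes finite_V: "finite V" and subspace_V: "subspace V"
    and zero_or_invertible: "(\<forall>x\<in>V. a \<star> x = 0) \<or> (\<exists>b. \<forall>x\<in>V. b \<star> a \<star> x = x)"
begin

text \<open>
  The submodules \<open>U\<close> and \<open>A x\<close> meet only in \<open>0\<close>: a scalar \<open>a\<close> with \<open>a x \<in> U\<close> either acts as \<open>0\<close> or has
  an inverse, which would put \<open>x\<close> into \<open>U\<close>. So \<open>u + a x \<mapsto> h u + a w\<close> is well defined.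
\<close>

lemma extend_linear_by_one:
  assumes U: "subspace U" "U \<subseteq> V" and x: "x \<in> V" "x \<notin> U" and w: "w \<in> V" and h: "linear_on U V h"
  obtains Y g where "subspace Y" "U \<subseteq> Y" "x \<in> Y" "Y \<subseteq> V" "linear_on Y V g"
    "\<And>y. y \<in> U \<Longrightarrow> g y = h y" "g x = w"
proof -
  define Y where "Y = {y + a \<star> x | y a. y \<in> U}"
  have key: "h y + a \<star> w = h y' + a' \<star> w"
    if "y \<in> U" "y' \<in> U" and e: "y + a \<star> x = y' + a' \<star> x" for y y' a a'
  proof -
    have "(a - a') \<star> x = y' - y"
      using e by (simp add: scale_left_diff_distrib algebra_simps)
    then have in_U: "(a - a') \<star> x \<in> U" using subspace_diff[OF U(1)] that by simp
    have *: "\<forall>v\<in>V. (a - a') \<star> v = 0"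
    proof (rule ccontr)
      assume "\<not> ?thesis"
      then obtain b where "b \<star> (a - a') \<star> x = x" using zero_or_invertible x by meson
      then have "x \<in> U" using subspace_scale[OF U(1) in_U, of b] by simp
      then show False using x by simp
    qed
    then have "a \<star> x = a' \<star> x" "a \<star> w = a' \<star> w"
      using x w by (auto simp: scale_left_diff_distrib)
    then show ?thesis using e by simp
  qed
  define g where "g z = (SOME u. \<exists>y a. y \<in> U \<and> z = y + a \<star> x \<and> u = h y + a \<star> w)" for z
  have g: "g (y + a \<star> x) = h y + a \<star> w" if "y \<in> U" for y a
    unfolding g_def
  proof (rule some_equality)
    show "\<exists>z b. z \<in> U \<and> y + a \<star> x = z + b \<star> x \<and> h y + a \<star> w = h z + b \<star> w" using that by blast
    show "u = h y + a \<star> w"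
      if "\<exists>z b. z \<in> U \<and> y + a \<star> x = z + b \<star> x \<and> u = h z + b \<star> w" for u
      using that key[OF \<open>y \<in> U\<close>] by metis
  qed
  have Y: "subspace Y"
  proof (rule subspaceI)
    show "0 \<in> Y" unfolding Y_def using subspace_0[OF U(1)] by (auto intro!: exI[of _ 0])
    show "u + v \<in> Y" if uv: "u \<in> Y" "v \<in> Y" for u v
    proof -
      obtain y a where u: "u = y + a \<star> x" "y \<in> U" using uv unfolding Y_def by auto
      obtain z b where v: "v = z + b \<star> x" "z \<in> U" using uv unfolding Y_def by auto
      have "u + v = (y + z) + (a + b) \<star> x" using u v by (simp add: scale_left_distrib algebra_simps)
      then show ?thesis unfolding Y_def using subspace_add[OF U(1) u(2) v(2)] by blast
    qed
    show "c \<star> u \<in> Y" if uv: "u \<in> Y" for c u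
    proof -
      obtain y a where u: "u = y + a \<star> x" "y \<in> U" using uv unfolding Y_def by auto
      have "c \<star> u = c \<star> y + (c * a) \<star> x" using u by (simp add: scale_right_distrib)
      then show ?thesis unfolding Y_def using subspace_scale[OF U(1) u(2)] by blast
    qed
  qed
  have UY: "U \<subseteq> Y"
  proof
    fix y assume "y \<in> U"
    moreover have "y = y + 0 \<star> x" by simp
    ultimately show "y \<in> Y" unfolding Y_def by blast
  qed
  have xY: "x \<in> Y"
    unfolding Y_def using subspace_0[OF U(1)] by (auto intro!: exI[of _ 0] exI[of _ 1])
  have YV: "Y \<subseteq> V"
    unfolding Y_def using U(2) x subspace_add[OF subspace_V] subspace_scale[OF subspace_V] by blast
  have lin: "linear_on Y V g"
  proof (rule linear_onI)
    show "g u \<in> V" if uv: "u \<in> Y" for u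
    proof -
      obtain y a where u: "u = y + a \<star> x" "y \<in> U" using uv unfolding Y_def by auto
      show ?thesis unfolding u(1) g[OF u(2)]
        using linear_onD(1)[OF h u(2)] w subspace_add[OF subspace_V] subspace_scale[OF subspace_V]
        by blast
    qed
    show "g (u + v) = g u + g v" if uv: "u \<in> Y" "v \<in> Y" for u v
    proof -
      obtain y a where u: "u = y + a \<star> x" "y \<in> U" using uv unfolding Y_def by auto
      obtain z b where v: "v = z + b \<star> x" "z \<in> U" using uv unfolding Y_def by auto
      have uv': "u + v = (y + z) + (a + b) \<star> x" using u v by (simp add: scale_left_distrib algebra_simps)
      show ?thesis unfolding uv' g[OF subspace_add[OF U(1) u(2) v(2)]]
        unfolding u(1) v(1) g[OF u(2)] g[OF v(2)] linear_onD(2)[OF h u(2) v(2)]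
        by (simp add: scale_left_distrib algebra_simps)
    qed
    show "g (c \<star> u) = c \<star> g u" if uv: "u \<in> Y" for c u
    proof -
      obtain y a where u: "u = y + a \<star> x" "y \<in> U" using uv unfolding Y_def by auto
      have cu: "c \<star> u = c \<star> y + (c * a) \<star> x" using u by (simp add: scale_right_distrib)
      show ?thesis unfolding cu g[OF subspace_scale[OF U(1) u(2)]]
        unfolding u(1) g[OF u(2)] linear_onD(3)[OF h u(2)] by (simp add: scale_right_distrib)
    qed
  qed
  show ?thesis
  proof (rule that[OF Y UY xY YV lin])
    show "g y = h y" if "y \<in> U" for y using g[OF that, of 0] by simp
    show "g x = w" using g[OF subspace_0[OF U(1)], of 1] linear_on_zero[OF h U(1)] by simp
  qed
qed

lemma extend_linear:
  assumes "subspace U" "U \<subseteq> V" "linear_on U V h"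
  shows "\<exists>g. linear_on V V g \<and> (\<forall>x\<in>U. g x = h x)"
  using assms
proof (induction "card (V - U)" arbitrary: U h rule: less_induct)
  case less
  show ?case
  proof (cases "U = V")
    case True
    then show ?thesis using less.prems by blast
  next
    case False
    then obtain x where x: "x \<in> V" "x \<notin> U" using less.prems by blast
    obtain Y g where Y: "subspace Y" "U \<subseteq> Y" "x \<in> Y" "Y \<subseteq> V" "linear_on Y V g"
      "\<And>y. y \<in> U \<Longrightarrow> g y = h y"
      using extend_linear_by_one[OF less.prems(1,2) x x(1) less.prems(3)] by metis
    have "card (V - Y) < card (V - U)"
      using Y x finite_V by (intro psubset_card_mono) auto
    from less.hyps[OF this Y(1,4,5)] obtain k where "linear_on V V k" "\<forall>x\<in>Y. k x = g x" by blast
    then show ?thesis using Y by (metis subsetD)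
  qed
qed

lemma separating_endomorphism:
  assumes "subspace W" "W \<subseteq> V" "v \<in> V" "v \<notin> W" "w \<in> V"
  obtains h where "linear_on V V h" "\<And>x. x \<in> W \<Longrightarrow> h x = 0" "h v = w"
proof -
  have "linear_on W V (\<lambda>_. 0)" using subspace_0[OF subspace_V] by (simp add: linear_on_def)
  from extend_linear_by_one[OF assms this]
  obtain Y g where Y: "subspace Y" "W \<subseteq> Y" "v \<in> Y" "Y \<subseteq> V" "linear_on Y V g"
    "\<And>y. y \<in> W \<Longrightarrow> g y = 0" "g v = w" by metis
  from extend_linear[OF Y(1,4,5)] obtain h where "linear_on V V h" "\<forall>x\<in>Y. h x = g x" by blast
  then show ?thesis using that[of h] Y by (metis subsetD)
qed

end

section \<open>The relative trace\<close>

text \<open>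
  Since \<open>S\<^sup>d\<close> acts as a scalar, conjugation by \<open>S\<close> has order dividing \<open>d\<close> on the linear endomorphisms of
  \<open>V\<close>. Summing over its powers gives the relative trace.
\<close>

locale twisted_operator_module = simple_torsion_module scale V
  for scale :: "'a::comm_ring_1 \<Rightarrow> 'b::ab_group_add \<Rightarrow> 'b" (infixr \<open>\<star>\<close> 75) and V :: "'b set" +
  fixes S :: "'b \<Rightarrow> 'b" and d :: nat
  assumes d_pos: "d > 0"
    and linear_S: "linear_on V V S"
    and inj_S: "inj_on S V"
    and S_pow_scalar: "\<exists>c. \<forall>x\<in>V. (S ^^ d) x = c \<star> x"
begin

abbreviation S_inv :: "'b \<Rightarrow> 'b" where "S_inv \<equiv> inv_into V S"

definition stable :: "'b set \<Rightarrow> bool"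
  where "stable U \<longleftrightarrow> subspace U \<and> U \<subseteq> V \<and> S ` U \<subseteq> U"

definition equivariant :: "'b set \<Rightarrow> ('b \<Rightarrow> 'b) \<Rightarrow> bool"
  where "equivariant U h \<longleftrightarrow> linear_on U V h \<and> (\<forall>x\<in>U. h (S x) = S (h x))"

definition relative_trace :: "('b \<Rightarrow> 'b) \<Rightarrow> 'b \<Rightarrow> 'b"
  where "relative_trace h x = (\<Sum>i<d. (S ^^ i) (h ((S_inv ^^ i) x)))"

lemma S_image: "stable U \<Longrightarrow> S ` U = U"
  unfolding stable_def
  by (metis endo_inj_surj finite_V finite_subset inj_S inj_on_subset)

lemma stable_V: "stable V"
  using subspace_V linear_onD(1)[OF linear_S] by (auto simp: stable_def)

lemma S_inv_stable: "stable U \<Longrightarrow> x \<in> U \<Longrightarrow> S_inv x \<in> U"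
  using S_image[of U] inv_into_f_f[OF inj_S] by (metis imageE stable_def subsetD)

lemma S_S_inv: "x \<in> V \<Longrightarrow> S (S_inv x) = x"
  using S_image[OF stable_V] f_inv_into_f by metis

lemma S_inv_S: "x \<in> V \<Longrightarrow> S_inv (S x) = x"
  using inv_into_f_f[OF inj_S] .

lemma S_inv_pow_stable: "stable U \<Longrightarrow> x \<in> U \<Longrightarrow> (S_inv ^^ i) x \<in> U"
  by (induction i) (auto intro: S_inv_stable)

lemma S_pow_stable: "stable U \<Longrightarrow> x \<in> U \<Longrightarrow> (S ^^ i) x \<in> U"
  by (induction i) (auto simp: stable_def)

lemma S_pow_S_inv_pow: "x \<in> V \<Longrightarrow> (S ^^ i) ((S_inv ^^ i) x) = x"
  by (induction i arbitrary: x)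
    (simp_all add: funpow_swap1[of S] S_S_inv S_inv_pow_stable[OF stable_V])

lemma linear_S_inv: "linear_on V V S_inv"
proof (rule linear_onI)
  show "S_inv x \<in> V" if "x \<in> V" for x using S_inv_stable[OF stable_V that] .
  show "S_inv (x + y) = S_inv x + S_inv y" if "x \<in> V" "y \<in> V" for x y
    using that linear_onD(2)[OF linear_S, of "S_inv x" "S_inv y"] S_S_inv S_inv_S
      S_inv_stable[OF stable_V] subspace_add[OF subspace_V] by metis
  show "S_inv (a \<star> x) = a \<star> S_inv x" if "x \<in> V" for a x
    using that linear_onD(3)[OF linear_S, of "S_inv x"] S_S_inv S_inv_S
      S_inv_stable[OF stable_V] subspace_scale[OF subspace_V] by metis
qed

lemma linear_relative_trace:
  assumes "linear_on V V h"
  shows "linear_on V V (relative_trace h)"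
  unfolding relative_trace_def
  by (intro linear_on_sum_of_maps[OF subspace_V] linear_on_comp[OF _ linear_on_funpow[OF linear_S]]
      linear_on_comp[OF linear_on_funpow[OF linear_S_inv]] assms) simp

text \<open>
  Conjugation by \<open>S\<close> permutes the summands cyclically; the summand that wraps around agrees with the
  first one because \<open>h\<close> commutes with the scalar \<open>S\<^sup>d\<close>.
\<close>

lemma equivariant_relative_trace:
  assumes h: "linear_on V V h"
  shows "equivariant V (relative_trace h)"
proof -
  have "relative_trace h (S x) = S (relative_trace h x)" if x: "x \<in> V" for x
  proof -
    obtain e where d: "d = Suc e" using d_pos gr0_conv_Suc by blast
    obtain c where c: "\<And>x. x \<in> V \<Longrightarrow> (S ^^ d) x = c \<star> x" using S_pow_scalar by blast
    have inV: "(S ^^ i) (h ((S_inv ^^ i) x)) \<in> V" for i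
      using S_pow_stable[OF stable_V] S_inv_pow_stable[OF stable_V] x linear_onD(1)[OF h] by blast
    let ?z = "(S_inv ^^ e) x"
    have z: "?z \<in> V" using S_inv_pow_stable[OF stable_V x] .
    have "S ((S ^^ e) (h ?z)) = (S ^^ d) (h ?z)" by (simp add: d)
    also have "\<dots> = h (c \<star> ?z)"
      using c[OF linear_onD(1)[OF h z]] linear_onD(3)[OF h z] by simp
    also have "c \<star> ?z = S x" using c[OF z] S_pow_S_inv_pow[OF x, of e] by (simp add: d)
    finally have last: "S ((S ^^ e) (h ?z)) = h (S x)" .
    have "S (relative_trace h x) = (\<Sum>i<d. S ((S ^^ i) (h ((S_inv ^^ i) x))))"
      unfolding relative_trace_def by (rule linear_on_sum[OF linear_S subspace_V]) (use inV in auto)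
    also have "\<dots> = h (S x) + (\<Sum>i<e. S ((S ^^ i) (h ((S_inv ^^ i) x))))"
      unfolding d using last by (simp add: add.commute)
    also have "\<dots> = (\<Sum>i<Suc e. (S ^^ i) (h ((S_inv ^^ i) (S x))))"
      by (subst sum.lessThan_Suc_shift) (simp add: funpow_swap1[of S_inv] S_inv_S[OF x])
    also have "\<dots> = relative_trace h (S x)" unfolding relative_trace_def d[symmetric] ..
    finally show ?thesis ..
  qed
  then show ?thesis using linear_relative_trace[OF h] by (simp add: equivariant_def)
qed

lemma equivariant_S_inv:
  assumes U: "stable U" and h: "equivariant U h" and x: "x \<in> U"
  shows "h ((S_inv ^^ i) x) = (S_inv ^^ i) (h x)"
proof (induction i)
  case (Suc i)
  let ?y = "(S_inv ^^ i) x"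
  have y: "?y \<in> U" and y': "S_inv ?y \<in> U"
    using S_inv_pow_stable[OF U x] S_inv_stable[OF U] by auto
  have "h ?y = S (h (S_inv ?y))"
    using h y' S_S_inv[of ?y] y U unfolding equivariant_def stable_def by (metis subsetD)
  then have "S_inv (h ?y) = h (S_inv ?y)"
    using S_inv_S h y' unfolding equivariant_def linear_on_def by metis
  then show ?case using Suc by simp
qed simp

end

section \<open>Injectivity and separation of points\<close>

text \<open>
  The first condition is Higman's criterion for relative projectivity. It makes \<open>V\<close> an injective module
  over the scalars and \<open>S\<close>. The second one keeps the relative trace of a composite \<open>e \<circ> h\<close> from
  vanishing at a chosen point when \<open>e\<close> varies.
\<close>

locale relative_trace_module = twisted_operator_module scale V S d
  for scale :: "'a::comm_ring_1 \<Rightarrow> 'b::ab_group_add \<Rightarrow> 'b" (infixr \<open>\<star>\<close> 75) and V :: "'b set"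
    and S :: "'b \<Rightarrow> 'b" and d :: nat +
  assumes trace_one: "\<exists>e. linear_on V V e \<and> (\<forall>x\<in>V. relative_trace e x = x)"
    and trace_separates:
      "(\<And>i. i < d \<Longrightarrow> c i \<in> V) \<Longrightarrow> c 0 \<noteq> 0 \<Longrightarrow>
         \<exists>e. linear_on V V e \<and> (\<Sum>i<d. (S ^^ i) (e (c i))) \<noteq> 0"
begin

text \<open>
  Let \<open>g\<close> be any linear extension and \<open>e\<close> of relative trace \<open>1\<close>. On \<open>U\<close> the map \<open>g = h\<close> commutes with
  \<open>S\<close> and can be moved out of the relative trace of \<open>e \<circ> g\<close>, which therefore agrees with \<open>h\<close> there.
\<close>

lemma extend_equivariant:
  assumes U: "stable U" and h: "equivariant U h"
  obtains g where "equivariant V g" "\<And>x. x \<in> U \<Longrightarrow> g x = h x"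
proof -
  obtain e where e: "linear_on V V e" "\<And>x. x \<in> V \<Longrightarrow> relative_trace e x = x"
    using trace_one by blast
  obtain g where g: "linear_on V V g" "\<And>x. x \<in> U \<Longrightarrow> g x = h x"
    using extend_linear U h unfolding stable_def equivariant_def by metis
  have "relative_trace (\<lambda>x. e (g x)) x = h x" if x: "x \<in> U" for x
  proof -
    have "g ((S_inv ^^ i) x) = (S_inv ^^ i) (h x)" for i
      using g(2)[OF S_inv_pow_stable[OF U x]] equivariant_S_inv[OF U h x] by simp
    then have "relative_trace (\<lambda>x. e (g x)) x = relative_trace e (h x)"
      unfolding relative_trace_def by simp
    then show ?thesis using e(2) h x unfolding equivariant_def linear_on_def by simp
  qed
  then show ?thesis
    using that equivariant_relative_trace[OF linear_on_comp[OF g(1) e(1)]] by blast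
qed

text \<open>
  A linear \<open>h\<close> with \<open>h(W) = 0\<close> and \<open>h v = v\<close> exists, but its relative trace may vanish at \<open>v\<close>.
  Composing with a suitable \<open>e\<close> prevents this, because the term with \<open>i = 0\<close> is \<open>e v\<close> and \<open>v \<noteq> 0\<close>.
\<close>

lemma stable_subspace_closed:
  assumes W: "stable W" and v: "v \<in> V" "v \<notin> W"
  obtains f where "equivariant V f" "\<And>x. x \<in> W \<Longrightarrow> f x = 0" "f v \<noteq> 0"
proof -
  have "subspace W" "W \<subseteq> V" using W by (auto simp: stable_def)
  from separating_endomorphism[OF this v v(1)]
  obtain h where h: "linear_on V V h" "\<And>x. x \<in> W \<Longrightarrow> h x = 0" "h v = v" by metis
  have "h ((S_inv ^^ i) v) \<in> V" for i
    using linear_onD(1)[OF h(1)] S_inv_pow_stable[OF stable_V v(1)] by blast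
  moreover have "v \<noteq> 0" using v W subspace_0 by (auto simp: stable_def)
  ultimately obtain e where e: "linear_on V V e" "(\<Sum>i<d. (S ^^ i) (e (h ((S_inv ^^ i) v)))) \<noteq> 0"
    using trace_separates[of "\<lambda>i. h ((S_inv ^^ i) v)"] h(3) by auto
  have S0: "(S ^^ i) 0 = 0" for i
    using linear_on_zero[OF linear_on_funpow[OF linear_S] subspace_V] .
  show ?thesis
  proof (rule that[OF equivariant_relative_trace[OF linear_on_comp[OF h(1) e(1)]]])
    show "relative_trace (\<lambda>x. e (h x)) x = 0" if "x \<in> W" for x
      using h(2)[OF S_inv_pow_stable[OF W that]] S0 linear_on_zero[OF e(1) subspace_V]
      by (simp add: relative_trace_def)
    show "relative_trace (\<lambda>x. e (h x)) v \<noteq> 0" using e(2) by (simp add: relative_trace_def)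
  qed
qed

text \<open>
  Induction on \<open>F\<close>, with \<open>N\<close> arbitrary. When \<open>k\<close> is added to \<open>F\<close>, the induction hypothesis on the
  kernel \<open>N'\<close> of \<open>k\<close> in \<open>N\<close> gives a combination of \<open>F\<close> that agrees with \<open>g\<close> on \<open>N'\<close>. The difference
  factors through \<open>k\<close>, and injectivity of \<open>V\<close> extends the second factor from \<open>k(N)\<close> to \<open>V\<close>.
\<close>

lemma equivariant_combination:
  assumes "finite F" "\<And>f. f \<in> F \<Longrightarrow> equivariant V f" "stable N" "equivariant N g"
    "\<And>x. x \<in> N \<Longrightarrow> (\<And>f. f \<in> F \<Longrightarrow> f x = 0) \<Longrightarrow> g x = 0"
  shows "\<exists>h. (\<forall>f\<in>F. equivariant V (h f)) \<and> (\<forall>x\<in>N. g x = (\<Sum>f\<in>F. h f (f x)))"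
  using assms
proof (induction F arbitrary: N g rule: finite_induct)
  case empty
  then show ?case by simp
next
  case (insert k F)
  note N = \<open>stable N\<close> and g = \<open>equivariant N g\<close>
  have k: "equivariant V k" using insert.prems(1) by simp
  have NV: "N \<subseteq> V" and Nsub: "subspace N" and SN: "\<And>x. x \<in> N \<Longrightarrow> S x \<in> N"
    using N by (auto simp: stable_def)
  have k_lin: "linear_on N V k" and k_S: "\<And>x. x \<in> N \<Longrightarrow> k (S x) = S (k x)"
    using k NV by (simp_all add: equivariant_def linear_on_def subset_iff)
  have g_lin: "linear_on N V g" and g_S: "\<And>x. x \<in> N \<Longrightarrow> g (S x) = S (g x)"
    using g by (auto simp: equivariant_def)
  define N' where "N' = {x \<in> N. k x = 0}"
  have S0: "S 0 = 0" using linear_on_zero[OF linear_S subspace_V] .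
  have N': "stable N'"
    unfolding stable_def N'_def
  proof (intro conjI subspaceI)
    show "0 \<in> {x \<in> N. k x = 0}"
      using subspace_0[OF Nsub] linear_on_zero[OF k_lin Nsub] by simp
  qed (use NV SN k_S S0 linear_onD[OF k_lin] subspace_add[OF Nsub] subspace_scale[OF Nsub] in auto)
  have "equivariant N' g" using g by (auto simp: equivariant_def linear_on_def N'_def)
  then have "\<exists>h. (\<forall>f\<in>F. equivariant V (h f)) \<and> (\<forall>x\<in>N'. g x = (\<Sum>f\<in>F. h f (f x)))"
    by (intro insert.IH N') (use insert.prems in \<open>auto simp: N'_def\<close>)
  then obtain h where h: "\<And>f. f \<in> F \<Longrightarrow> equivariant V (h f)"
    "\<And>x. x \<in> N' \<Longrightarrow> g x = (\<Sum>f\<in>F. h f (f x))" by blast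
  define g' where "g' x = g x - (\<Sum>f\<in>F. h f (f x))" for x
  have hf: "equivariant V (\<lambda>x. h f (f x))" if "f \<in> F" for f
  proof -
    have "linear_on V V f" "linear_on V V (h f)" "\<And>x. x \<in> V \<Longrightarrow> f (S x) = S (f x)"
      "\<And>x. x \<in> V \<Longrightarrow> h f (S x) = S (h f x)"
      using h(1)[OF that] insert.prems(1)[of f] that by (auto simp: equivariant_def)
    then show ?thesis
      using linear_on_comp linear_onD(1)[of V V f] unfolding equivariant_def by metis
  qed
  have sum_lin: "linear_on V V (\<lambda>x. \<Sum>f\<in>F. h f (f x))"
  proof (rule linear_on_sum_of_maps[OF subspace_V insert.hyps(1)])
    show "linear_on V V (\<lambda>x. h f (f x))" if "f \<in> F" for f
      using hf[OF that] unfolding equivariant_def by (rule conjunct1)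
  qed
  have g'_lin: "linear_on N V g'"
  proof (rule linear_onI)
    fix x assume x: "x \<in> N"
    then have xV: "x \<in> V" using NV by blast
    show "g' x \<in> V"
      unfolding g'_def
      by (rule subspace_diff[OF subspace_V linear_onD(1)[OF g_lin x] linear_onD(1)[OF sum_lin xV]])
    show "g' (c \<star> x) = c \<star> g' x" for c
      unfolding g'_def linear_onD(3)[OF g_lin x] linear_onD(3)[OF sum_lin xV]
      by (simp add: scale_right_diff_distrib)
    fix y assume y: "y \<in> N"
    then have yV: "y \<in> V" using NV by blast
    show "g' (x + y) = g' x + g' y"
      unfolding g'_def linear_onD(2)[OF g_lin x y] linear_onD(2)[OF sum_lin xV yV] by simp
  qed
  have g'_S: "g' (S x) = S (g' x)" if x: "x \<in> N" for x
  proof -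
    have "S (\<Sum>f\<in>F. h f (f x)) = (\<Sum>f\<in>F. h f (f (S x)))"
    proof (subst linear_on_sum[OF linear_S subspace_V insert.hyps(1)])
      have xV: "x \<in> V" using x NV by blast
      show "h f (f x) \<in> V" if "f \<in> F" for f
        using hf[OF that] linear_onD(1) xV unfolding equivariant_def by metis
      show "(\<Sum>f\<in>F. S (h f (f x))) = (\<Sum>f\<in>F. h f (f (S x)))"
      proof (rule sum.cong)
        fix f assume "f \<in> F"
        with hf[of f] xV show "S (h f (f x)) = h f (f (S x))" unfolding equivariant_def by metis
      qed simp
    qed
    moreover have "S (g x - (\<Sum>f\<in>F. h f (f x))) = S (g x) - S (\<Sum>f\<in>F. h f (f x))"
      using x NV by (intro linear_on_diff[OF linear_S subspace_V] linear_onD(1)[OF g_lin]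
          linear_onD(1)[OF sum_lin]) auto
    ultimately show ?thesis unfolding g'_def using g_S[OF x] by simp
  qed
  have g'_eq: "g' x = g' y" if "x \<in> N" "y \<in> N" "k x = k y" for x y
  proof -
    have "x - y \<in> N'"
      using that linear_on_diff[OF k_lin Nsub] subspace_diff[OF Nsub] by (simp add: N'_def)
    then have "g' (x - y) = 0" using h(2) by (simp add: g'_def)
    then show ?thesis using linear_on_diff[OF g'_lin Nsub] that by simp
  qed
  define u where "u z = g' (SOME x. x \<in> N \<and> k x = z)" for z
  have u: "u (k x) = g' x" if "x \<in> N" for x
    unfolding u_def
  proof (rule someI2[of _ x])
    show "g' y = g' x" if "y \<in> N \<and> k y = k x" for y
      using g'_eq \<open>x \<in> N\<close> that by blast
  qed (use that in simp)
  have kN: "stable (k ` N)"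
    unfolding stable_def
  proof (intro conjI subspaceI)
    show "0 \<in> k ` N" using subspace_0[OF Nsub] linear_on_zero[OF k_lin Nsub] by force
    show "x + y \<in> k ` N" if "x \<in> k ` N" "y \<in> k ` N" for x y
    proof -
      from that obtain a b where "x = k a" "y = k b" "a \<in> N" "b \<in> N" by auto
      then show ?thesis
        using linear_onD(2)[OF k_lin, of a b] subspace_add[OF Nsub, of a b] by (metis imageI)
    qed
    show "c \<star> x \<in> k ` N" if "x \<in> k ` N" for c x
    proof -
      from that obtain a where "x = k a" "a \<in> N" by auto
      then show ?thesis
        using linear_onD(3)[OF k_lin, of a] subspace_scale[OF Nsub, of a] by (metis imageI)
    qed
    show "k ` N \<subseteq> V" using linear_onD(1)[OF k_lin] by auto
    show "S ` k ` N \<subseteq> k ` N"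
    proof clarify
      fix x assume "x \<in> N"
      then show "S (k x) \<in> k ` N" using k_S[of x] SN[of x] by (metis imageI)
    qed
  qed
  have "equivariant (k ` N) u"
    unfolding equivariant_def
  proof (intro conjI linear_onI ballI)
    show "u (x + y) = u x + u y" if xy: "x \<in> k ` N" "y \<in> k ` N" for x y
    proof -
      obtain a b where ab: "x = k a" "y = k b" "a \<in> N" "b \<in> N" using xy by auto
      then have "x + y = k (a + b)" using linear_onD(2)[OF k_lin] by simp
      then show ?thesis using u ab linear_onD(2)[OF g'_lin] subspace_add[OF Nsub] by simp
    qed
    show "u (c \<star> x) = c \<star> u x" if xy: "x \<in> k ` N" for c x
    proof -
      obtain a where ab: "x = k a" "a \<in> N" using xy by auto
      then have "c \<star> x = k (c \<star> a)" using linear_onD(3)[OF k_lin] by simp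
      then show ?thesis using u ab linear_onD(3)[OF g'_lin] subspace_scale[OF Nsub] by simp
    qed
    show "u (S x) = S (u x)" if xy: "x \<in> k ` N" for x
    proof -
      obtain a where ab: "x = k a" "a \<in> N" using xy by auto
      then have "S x = k (S a)" using k_S by simp
      then show ?thesis using u ab g'_S SN by simp
    qed
  qed (use u linear_onD(1)[OF g'_lin] in auto)
  from extend_equivariant[OF kN this]
  obtain v where v: "equivariant V v" "\<And>x. x \<in> k ` N \<Longrightarrow> v x = u x" by metis
  show ?case
  proof (intro exI[of _ "h(k := v)"] conjI ballI)
    show "equivariant V ((h(k := v)) f)" if "f \<in> insert k F" for f
      using that h(1) v(1) by auto
    show "g x = (\<Sum>f\<in>insert k F. (h(k := v)) f (f x))" if x: "x \<in> N" for x
    proof -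
      have "(\<Sum>f\<in>F. (h(k := v)) f (f x)) = (\<Sum>f\<in>F. h f (f x))"
        using insert.hyps(2) by (intro sum.cong) auto
      then show ?thesis using insert.hyps v(2)[of "k x"] u[OF x] x by (simp add: g'_def)
    qed
  qed
qed

end

section \<open>Frobenius powers on the algebraic closure\<close>

lemma CARD_gt_1: "CARD('k::finite_field) > 1"
proof -
  have "card {0, 1 :: 'k} \<le> CARD('k)" by (rule card_mono) auto
  then show ?thesis by simp
qed

text \<open>
  Translation by \<open>1\<close> permutes the finite field, so the sum of all elements equals itself plus \<open>q\<close>.
\<close>

lemma CARD_power_eq_0:
  assumes "n > 0"
  shows "of_nat (CARD('k::finite_field) ^ n) = (0 :: 'k alg_closure)"
proof -
  have "(\<Sum>x\<in>UNIV. x + 1) = (\<Sum>x\<in>UNIV. x :: 'k)"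
    by (rule sum.reindex_bij_witness[of _ "\<lambda>x. x - 1" "\<lambda>x. x + 1"]) auto
  then have "of_nat CARD('k) = (0 :: 'k)" by (simp add: sum.distrib)
  then have "of_nat CARD('k) = (0 :: 'k alg_closure)" using to_ac_of_nat to_ac_0 by metis
  then show ?thesis using assms by (simp add: power_0_left)
qed

lemma to_ac_power_CARD: "to_ac (c :: 'k::finite_field) ^ (CARD('k) ^ i) = to_ac c"
  by (simp flip: to_ac_power add: finite_field_power_card_power_eq_same)

text \<open>
  This avoids writing \<open>q\<close> as a power of the characteristic: \<open>(T + 1)\<^sup>q - T\<^sup>q - 1\<close> has degree less than
  \<open>q\<close> but vanishes at the \<open>q\<close> elements of the ground field, so it is zero.
\<close>

lemma frobenius_add_one:
  fixes x :: "'k::finite_field alg_closure"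
  shows "(x + 1) ^ CARD('k) = x ^ CARD('k) + 1"
proof -
  let ?q = "CARD('k)"
  have q: "?q > 1" by (rule CARD_gt_1)
  define f where "f = [:1, 1:] ^ ?q - (Polynomial.monom 1 ?q + 1 :: 'k alg_closure poly)"
  have f: "poly f x = (x + 1) ^ ?q - (x ^ ?q + 1)" for x
    by (simp add: f_def poly_monom add.commute)
  have "f = 0"
  proof (rule ccontr)
    assume "f \<noteq> 0"
    have lin: "Polynomial.degree ([:1, 1:] ^ ?q :: 'k alg_closure poly) = ?q"
      by (simp add: degree_power_eq)
    have lead: "Polynomial.coeff ([:1, 1:] ^ ?q :: 'k alg_closure poly) ?q = 1"
      using lead_coeff_power[of "[:1, 1:] :: 'k alg_closure poly" ?q] lin by simp
    have "Polynomial.degree f < ?q"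
    proof (rule degree_lessI)
      show "f \<noteq> 0 \<or> 0 < ?q" using q by simp
      show "\<forall>k\<ge>?q. Polynomial.coeff f k = 0"
      proof (intro allI impI)
        fix k assume "k \<ge> ?q"
        then show "Polynomial.coeff f k = 0"
          using lead coeff_eq_0[of "[:1, 1:] ^ ?q :: 'k alg_closure poly" k] lin q
          by (cases "k = ?q") (auto simp: f_def)
      qed
    qed
    moreover have "?q \<le> card {x. poly f x = 0}"
    proof -
      have "poly f (to_ac c) = 0" for c
        using to_ac_power_CARD[of "c + 1" 1] to_ac_power_CARD[of c 1] by (simp add: f)
      then have "card (range (to_ac :: 'k \<Rightarrow> _)) \<le> card {x. poly f x = 0}"
        by (intro card_mono poly_roots_finite \<open>f \<noteq> 0\<close>) auto
      then show ?thesis by (simp add: card_image inj_to_ac)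
    qed
    ultimately show False using card_poly_roots_bound[OF \<open>f \<noteq> 0\<close>] by simp
  qed
  then show ?thesis using f[of x] by simp
qed

lemma frobenius_add:
  fixes x y :: "'k::finite_field alg_closure"
  shows "(x + y) ^ (CARD('k) ^ i) = x ^ (CARD('k) ^ i) + y ^ (CARD('k) ^ i)"
proof -
  have step: "(x + y) ^ CARD('k) = x ^ CARD('k) + y ^ CARD('k)" for x y :: "'k alg_closure"
  proof (cases "y = 0")
    case False
    then have "(x + y) ^ CARD('k) = (y * (x / y + 1)) ^ CARD('k)" by (simp add: distrib_left)
    also have "\<dots> = y ^ CARD('k) * ((x / y) ^ CARD('k) + 1)"
      by (simp only: power_mult_distrib frobenius_add_one)
    finally show ?thesis using False by (simp add: power_divide distrib_left)
  qed (use CARD_gt_1[where 'k = 'k] in \<open>simp add: power_0_left\<close>)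
  show ?thesis
  proof (induction i)
    case (Suc i)
    show ?case unfolding power_Suc2 power_mult Suc step ..
  qed simp
qed

lemma CARD_power_pos: "CARD('k::finite_field) ^ i > 0"
  using CARD_gt_1[where 'k = 'k] by simp

lemma frobenius_minus:
  fixes x :: "'k::finite_field alg_closure"
  shows "(- x) ^ (CARD('k) ^ i) = - (x ^ (CARD('k) ^ i))"
proof -
  have "(- x) ^ (CARD('k) ^ i) + x ^ (CARD('k) ^ i) = 0"
    using frobenius_add[of "- x" x i] CARD_power_pos[where 'k = 'k, of i] by (simp add: power_0_left)
  then show ?thesis by (simp add: eq_neg_iff_add_eq_0)
qed

lemma frobenius_diff:
  fixes x y :: "'k::finite_field alg_closure"
  shows "(x - y) ^ (CARD('k) ^ i) = x ^ (CARD('k) ^ i) - y ^ (CARD('k) ^ i)"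
  using frobenius_add[of x "- y" i] by (simp add: frobenius_minus)

lemma frobenius_sum:
  fixes f :: "'i \<Rightarrow> 'k::finite_field alg_closure"
  shows "(\<Sum>j\<in>I. f j) ^ (CARD('k) ^ i) = (\<Sum>j\<in>I. f j ^ (CARD('k) ^ i))"
  using CARD_power_pos[where 'k = 'k, of i]
  by (induction I rule: infinite_finite_induct) (simp_all add: power_0_left frobenius_add)

lemma frobenius_inj:
  fixes x y :: "'k::finite_field alg_closure"
  assumes "x ^ (CARD('k) ^ i) = y ^ (CARD('k) ^ i)"
  shows "x = y"
  using frobenius_diff[of x y i] assms by simp

lemma frobenius_frobenius:
  fixes x :: "'k::finite_field alg_closure"
  shows "(x ^ (CARD('k) ^ i)) ^ (CARD('k) ^ j) = x ^ (CARD('k) ^ (i + j))"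
  by (simp add: power_add power_mult)

lemma Fq_ext_frobenius_mult:
  assumes "x \<in> (Fq_ext n :: 'k::finite_field alg_closure set)"
  shows "x ^ (CARD('k) ^ (n * k)) = x"
proof (induction k)
  case (Suc k)
  have "x ^ (CARD('k) ^ (n * Suc k)) = (x ^ (CARD('k) ^ n)) ^ (CARD('k) ^ (n * k))"
    by (simp only: frobenius_frobenius mult_Suc_right)
  then show ?case using Suc assms by (simp add: Fq_ext_def)
qed simp

lemma Fq_ext_frobenius_mod:
  assumes "x \<in> (Fq_ext n :: 'k::finite_field alg_closure set)"
  shows "x ^ (CARD('k) ^ k) = x ^ (CARD('k) ^ (k mod n))"
proof -
  have "x ^ (CARD('k) ^ k) = (x ^ (CARD('k) ^ (n * (k div n)))) ^ (CARD('k) ^ (k mod n))"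
    by (simp only: frobenius_frobenius mult_div_mod_eq)
  then show ?thesis using Fq_ext_frobenius_mult[OF assms] by simp
qed

lemma Fq_ext_power_CARD:
  assumes "x \<in> (Fq_ext n :: 'k::finite_field alg_closure set)"
  shows "x ^ (CARD('k) ^ i) \<in> Fq_ext n"
proof -
  have "(x ^ (CARD('k) ^ i)) ^ (CARD('k) ^ n) = (x ^ (CARD('k) ^ n)) ^ (CARD('k) ^ i)"
    by (simp only: frobenius_frobenius add.commute)
  then show ?thesis using assms by (simp add: Fq_ext_def)
qed

lemma Fq_ext_sum:
  "(\<And>i. i \<in> I \<Longrightarrow> f i \<in> Fq_ext n) \<Longrightarrow> (\<Sum>i\<in>I. f i) \<in> (Fq_ext n :: 'k::finite_field alg_closure set)"
  by (simp add: Fq_ext_def frobenius_sum)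

lemma Fq_ext_divide:
  "x \<in> Fq_ext n \<Longrightarrow> y \<in> Fq_ext n \<Longrightarrow> x / y \<in> (Fq_ext n :: 'k::finite_field alg_closure set)"
  by (simp add: Fq_ext_def power_divide)

lemma card_roots_separable:
  fixes f :: "'a::alg_closed_field poly"
  assumes "f \<noteq> 0" and sep: "\<And>x. poly f x = 0 \<Longrightarrow> poly (pderiv f) x \<noteq> 0"
  shows "card {x. poly f x = 0} = Polynomial.degree f"
proof -
  obtain A where A: "size A = Polynomial.degree f"
    "f = Polynomial.smult (Polynomial.lead_coeff f) (\<Prod>x\<in>#A. [:-x, 1:])"
    using alg_closed_imp_factorization[OF assms(1)] by blast
  have "count A x \<le> 1" for x
  proof (rule ccontr)
    assume "\<not> count A x \<le> 1"
    then have "{#x, x#} \<subseteq># A" by (simp add: subseteq_mset_def)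
    then obtain B where B: "A = {#x, x#} + B" by (metis subset_mset.add_diff_inverse)
    define c where "c = Polynomial.lead_coeff f"
    have "f = [:-x, 1:] * ([:-x, 1:] * Polynomial.smult c (\<Prod>x\<in>#B. [:-x, 1:]))"
      using A(2) unfolding B c_def[symmetric]
      by (simp add: mult_smult_right del: mult_pCons_left mult_pCons_right)
    then obtain g where "f = [:-x, 1:] * ([:-x, 1:] * g)" by blast
    then have "poly f x = 0" "poly (pderiv f) x = 0"
      by (simp_all add: pderiv_mult del: mult_pCons_left mult_pCons_right)
    then show False using sep by blast
  qed
  then have "\<And>x. x \<in># A \<Longrightarrow> count A x = 1"
    by (metis count_greater_zero_iff le_antisym less_eq_Suc_le One_nat_def)
  then have "size A = card (set_mset A)" by (simp add: size_multiset_overloaded_eq)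
  moreover have "set_mset A = {x. poly f x = 0}"
  proof -
    have "poly f x = Polynomial.lead_coeff f * (\<Prod>y\<in>#A. x - y)" for x
      by (subst A(2)) (simp add: poly_prod_mset image_mset.compositionality o_def)
    then show ?thesis using assms(1) by auto
  qed
  ultimately show ?thesis using A(1) by simp
qed

lemma card_Fq_ext:
  assumes n: "n > 0"
  shows "card (Fq_ext n :: 'k::finite_field alg_closure set) = CARD('k) ^ n"
proof -
  let ?N = "CARD('k) ^ n"
  define f where "f = Polynomial.monom 1 ?N - [:0, 1 :: 'k alg_closure:]"
  have N: "?N > 1" using CARD_gt_1[where 'k = 'k] n by (rule one_less_power)
  have deg: "Polynomial.degree f = ?N"
    unfolding f_def using N
    by (subst diff_conv_add_uminus, subst degree_add_eq_left)
      (simp_all add: Polynomial.degree_monom_eq)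
  have "pderiv f = - 1"
    using CARD_power_eq_0[OF n, where 'k = 'k]
    by (simp add: f_def pderiv_diff pderiv_monom pderiv_pCons one_pCons power_0_left n)
  then have "card {x. poly f x = 0} = Polynomial.degree f"
    by (intro card_roots_separable) (use deg N in auto)
  moreover have "{x. poly f x = 0} = Fq_ext n"
    by (auto simp: f_def Fq_ext_def poly_monom)
  ultimately show ?thesis using deg by simp
qed

text \<open>
  The sum is a polynomial in \<open>z\<close> of degree at most \<open>q^(n-1)\<close> with distinct exponents, and cannot vanish
  at all \<open>q^n\<close> elements of \<open>F_{q^n}\<close>.
\<close>

lemma frobenius_twists_independent:
  fixes c :: "nat \<Rightarrow> 'k::finite_field alg_closure"
  assumes n: "n > 0" and k: "inj_on k {..<d}" "\<And>i. i < d \<Longrightarrow> k i < n"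
    and nz: "j < d" "c j \<noteq> 0"
  obtains z where "z \<in> Fq_ext n" "(\<Sum>i<d. c i * z ^ (CARD('k) ^ k i)) \<noteq> 0"
proof -
  let ?q = "CARD('k)"
  define f where "f = (\<Sum>i<d. Polynomial.monom (c i) (?q ^ k i))"
  have q: "?q > 1" by (rule CARD_gt_1)
  have "Polynomial.coeff f (?q ^ k j) = (\<Sum>i<d. if i = j then c i else 0)"
    unfolding f_def Polynomial.coeff_sum
  proof (rule sum.cong)
    fix i assume "i \<in> {..<d}"
    then show "Polynomial.coeff (Polynomial.monom (c i) (?q ^ k i)) (?q ^ k j) = (if i = j then c i else 0)"
      using k(1) nz(1) q by (auto simp: inj_on_def power_inject_exp)
  qed simp
  then have "f \<noteq> 0" using nz by auto
  have "Polynomial.degree f \<le> ?q ^ (n - 1)"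
    unfolding f_def
  proof (rule degree_sum_le)
    fix i assume "i \<in> {..<d}"
    then have "?q ^ k i \<le> ?q ^ (n - 1)"
      using k(2)[of i] q by (intro power_increasing) auto
    then show "Polynomial.degree (Polynomial.monom (c i) (?q ^ k i)) \<le> ?q ^ (n - 1)"
      using Polynomial.degree_monom_le[of "c i"] order_trans by blast
  qed simp
  also have "\<dots> < ?q ^ n" using q n by (intro power_strict_increasing) auto
  finally have "card {x. poly f x = 0} < card (Fq_ext n :: 'k alg_closure set)"
    using card_poly_roots_bound[OF \<open>f \<noteq> 0\<close>] card_Fq_ext[OF n, where 'k = 'k] by simp
  then have "\<not> (Fq_ext n \<subseteq> {x. poly f x = 0})"
    using card_mono[OF poly_roots_finite[OF \<open>f \<noteq> 0\<close>]] by (meson not_le)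
  then show ?thesis using that by (auto simp: f_def poly_sum poly_monom)
qed

section \<open>Twisted polynomials as additive maps\<close>

text \<open>
  With \<open>w i = x^(q^i)\<close> this is the action of a twisted polynomial on \<open>x\<close>; with \<open>w i = \<phi>\<^sub>T\<^sup>i(x)\<close> it evaluates
  an ordinary polynomial over the algebraic closure, coefficients on the left, at \<open>\<phi>\<^sub>T\<close>.
\<close>

definition coeff_pairing :: "(nat \<Rightarrow> 'a) \<Rightarrow> 'a::comm_ring_1 poly \<Rightarrow> 'a"
  where "coeff_pairing w f = (\<Sum>i\<le>Polynomial.degree f. Polynomial.coeff f i * w i)"

lemma coeff_pairing_altdef:
  assumes "Polynomial.degree f \<le> N"
  shows "coeff_pairing w f = (\<Sum>i\<le>N. Polynomial.coeff f i * w i)"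
  unfolding coeff_pairing_def
  by (rule sum.mono_neutral_left) (use assms in \<open>auto simp: coeff_eq_0\<close>)

lemma coeff_pairing_0 [simp]: "coeff_pairing w 0 = 0"
  by (simp add: coeff_pairing_def)

lemma coeff_pairing_add: "coeff_pairing w (f + g) = coeff_pairing w f + coeff_pairing w g"
proof -
  let ?N = "max (Polynomial.degree f) (Polynomial.degree g)"
  have "Polynomial.degree (f + g) \<le> ?N" by (rule degree_add_le_max)
  then show ?thesis
    by (simp add: coeff_pairing_altdef[of _ ?N] sum.distrib distrib_right)
qed

lemma coeff_pairing_sum: "coeff_pairing w (\<Sum>i\<in>I. f i) = (\<Sum>i\<in>I. coeff_pairing w (f i))"
  by (induction I rule: infinite_finite_induct) (simp_all add: coeff_pairing_add)

lemma coeff_pairing_smult: "coeff_pairing w (Polynomial.smult c f) = c * coeff_pairing w f"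
  using coeff_pairing_altdef[OF degree_smult_le[of c f], of w]
  by (simp add: coeff_pairing_def sum_distrib_left mult.assoc)

lemma coeff_pairing_pCons: "coeff_pairing w (pCons c f) = c * w 0 + coeff_pairing (\<lambda>i. w (Suc i)) f"
proof -
  have "Polynomial.degree (pCons c f) \<le> Suc (Polynomial.degree f)" by (rule degree_pCons_le)
  from coeff_pairing_altdef[OF this, of w] show ?thesis
    unfolding sum.atMost_Suc_shift by (simp add: coeff_pairing_def)
qed

lemma coeff_pairing_monom: "coeff_pairing w (Polynomial.monom c i) = c * w i"
  by (induction i arbitrary: w) (simp_all add: coeff_pairing_pCons monom_Suc monom_0)

lemma twisted_apply_pairing:
  fixes f :: "'k::finite_field alg_closure poly"
  shows "twisted_apply f x = coeff_pairing (\<lambda>i. x ^ (CARD('k) ^ i)) f"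
  by (simp add: twisted_apply_def coeff_pairing_def)

lemma twisted_apply_add: "twisted_apply (f + g) x = twisted_apply f x + twisted_apply g x"
  by (simp add: twisted_apply_pairing coeff_pairing_add)

lemma twisted_apply_monom:
  fixes c :: "'k::finite_field alg_closure"
  shows "twisted_apply (Polynomial.monom c i) x = c * x ^ (CARD('k) ^ i)"
  by (simp add: twisted_apply_pairing coeff_pairing_monom)

lemma twisted_apply_const: "twisted_apply [:c:] x = c * x"
  by (simp add: twisted_apply_def)

lemma twisted_apply_arg_add: "twisted_apply f (x + y) = twisted_apply f x + twisted_apply f y"
  by (simp add: twisted_apply_def frobenius_add distrib_left sum.distrib)

lemma twisted_apply_mult: "twisted_apply (twisted_mult f g) x = twisted_apply f (twisted_apply g x)"
  by (simp add: twisted_mult_def twisted_apply_pairing coeff_pairing_sum coeff_pairing_monom)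
    (simp add: coeff_pairing_def frobenius_sum power_mult_distrib frobenius_frobenius sum_distrib_left
      mult.assoc add.commute)

lemma twisted_apply_frobenius:
  fixes f :: "'k::finite_field alg_closure poly"
  assumes "\<And>i. Polynomial.coeff f i \<in> Fq_ext r"
  shows "twisted_apply f (x ^ (CARD('k) ^ (r * m))) = twisted_apply f x ^ (CARD('k) ^ (r * m))"
  using Fq_ext_frobenius_mult[OF assms]
  by (simp add: twisted_apply_def frobenius_sum power_mult_distrib frobenius_frobenius add.commute)

lemma twisted_ring_pow_monom:
  "Polynomial.monom 1 r [^]\<^bsub>twisted_ring r\<^esub> m = Polynomial.monom (1 :: 'k::finite_field alg_closure) (r * m)"
proof (induction m)
  case 0
  then show ?case by (simp add: twisted_ring_def nat_pow_def monom_0 one_pCons)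
next
  case (Suc m)
  have mult: "twisted_mult (Polynomial.monom 1 i) (Polynomial.monom 1 j) =
    Polynomial.monom (1 :: 'k alg_closure) (i + j)" for i j
  proof -
    have "twisted_mult (Polynomial.monom 1 i) (Polynomial.monom 1 j) =
      (\<Sum>a\<le>i. \<Sum>b\<le>j. if a = i then if b = j then Polynomial.monom (1 :: 'k alg_closure) (i + j) else 0 else 0)"
      unfolding twisted_mult_def
      by (simp add: Polynomial.degree_monom_eq, intro sum.cong refl)
        (auto simp: CARD_power_pos power_0_left)
    also have "\<dots> = (\<Sum>a\<le>i. if a = i then Polynomial.monom 1 (i + j) else 0)"
      by (intro sum.cong refl) simp
    finally show ?thesis by simp
  qed
  show ?case using Suc by (simp add: nat_pow_def) (simp add: twisted_ring_def mult add.commute)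
qed

section \<open>Irreducible polynomials and their roots\<close>

text \<open>
  A nonzero combination \<open>g\<close> of \<open>a\<close> and \<open>p\<close> of minimal degree divides both, hence is a unit.
\<close>

lemma irreducible_bezout:
  fixes p a :: "'k::field poly"
  assumes p: "Factorial_Ring.irreducible p" and a: "\<not> p dvd a"
  obtains b where "p dvd b * a - 1"
proof -
  define I where "I g \<longleftrightarrow> (\<exists>u v. g = u * a + v * p) \<and> g \<noteq> 0" for g
  have "I a" unfolding I_def using a by (intro conjI exI[of _ 1] exI[of _ 0]) auto
  then obtain g where g: "I g" "\<And>h. I h \<Longrightarrow> Polynomial.degree g \<le> Polynomial.degree h"
    using exists_least_iff[of "\<lambda>k. \<exists>g. I g \<and> Polynomial.degree g = k"] by (metis not_le)
  then obtain u v where uv: "g = u * a + v * p" "g \<noteq> 0" unfolding I_def by blast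
  have dvd: "g dvd x * a + y * p" for x y
  proof (rule ccontr)
    let ?z = "x * a + y * p"
    assume "\<not> g dvd ?z"
    then have nz: "?z mod g \<noteq> 0" by (simp add: dvd_eq_mod_eq_0)
    have "?z mod g = (x - ?z div g * u) * a + (y - ?z div g * v) * p"
    proof -
      define k where "k = ?z div g"
      have "?z mod g = ?z - k * g" by (simp add: k_def minus_div_mult_eq_mod)
      also have "k * g = k * (u * a + v * p)" using uv(1) by simp
      finally show ?thesis unfolding k_def[symmetric] by (simp add: algebra_simps)
    qed
    then have "I (?z mod g)" unfolding I_def using nz by blast
    from g(2)[OF this] degree_mod_less'[OF uv(2) nz] show False by simp
  qed
  have "g dvd p" "g dvd a" using dvd[of 0 1] dvd[of 1 0] by simp_all
  then have "is_unit g" using p a by (metis dvd_trans irreducibleD')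
  then obtain w where w: "1 = g * w" by (rule dvdE)
  then have "(w * u) * a - 1 = p * (- (w * v))" using uv(1) by (simp add: algebra_simps)
  then show ?thesis using that[of "w * u"] by (metis dvd_triv_left)
qed

text \<open>
  The \<open>q^(deg p)\<close> polynomials of degree less than \<open>deg p\<close> take distinct values at \<open>t\<close>, and all these
  values lie in \<open>F_{q^k}\<close>.
\<close>

lemma root_in_Fq_ext_degree_le:
  fixes p :: "'k::finite_field poly"
  assumes p: "Factorial_Ring.irreducible p" and root: "poly (map_poly to_ac p) t = 0"
    and t: "t \<in> Fq_ext k" and k: "k > 0"
  shows "Polynomial.degree p \<le> k"
proof -
  let ?r = "Polynomial.degree p"
  define ev where "ev f = (\<Sum>i<?r. to_ac (f i) * t ^ i)" for f :: "nat \<Rightarrow> 'k"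
  have hom: "poly (map_poly to_ac (a + b)) t = poly (map_poly to_ac a) t + poly (map_poly to_ac b) t"
    for a b :: "'k poly"
  proof -
    have "map_poly to_ac (a + b) = map_poly to_ac a + map_poly to_ac b"
      by (intro poly_eqI) (simp add: coeff_map_poly)
    then show ?thesis by simp
  qed
  have mul: "poly (map_poly to_ac (a * b)) t = poly (map_poly to_ac a) t * poly (map_poly to_ac b) t"
    for a b :: "'k poly"
  proof -
    have "map_poly to_ac (a * b) = map_poly to_ac a * map_poly to_ac b"
      by (intro poly_eqI) (simp add: coeff_map_poly coeff_mult to_ac_sum)
    then show ?thesis by simp
  qed
  have "inj_on ev ({..<?r} \<rightarrow>\<^sub>E UNIV)"
  proof (rule inj_onI)
    fix f g assume fg: "f \<in> {..<?r} \<rightarrow>\<^sub>E UNIV" "g \<in> {..<?r} \<rightarrow>\<^sub>E UNIV" "ev f = ev g"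
    define a where "a = (\<Sum>i<?r. Polynomial.monom (f i - g i) i)"
    have coeff_a: "Polynomial.coeff a j = (if j < ?r then f j - g j else 0)" for j
      by (simp add: a_def Polynomial.coeff_sum)
    have "map_poly to_ac a = (\<Sum>i<?r. Polynomial.monom (to_ac (f i) - to_ac (g i)) i)"
      by (intro poly_eqI) (simp add: coeff_map_poly coeff_a Polynomial.coeff_sum)
    then have "poly (map_poly to_ac a) t = ev f - ev g"
      by (simp add: poly_sum poly_monom ev_def left_diff_distrib sum_subtractf)
    then have ev_a: "poly (map_poly to_ac a) t = 0" using fg(3) by simp
    have "p dvd a"
    proof (rule ccontr)
      assume "\<not> p dvd a"
      then obtain b where "p dvd b * a - 1" using irreducible_bezout[OF p] by blast
      then obtain s where "b * a = 1 + p * s" by (metis dvd_def add.commute diff_add_cancel)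
      then have "poly (map_poly to_ac (b * a)) t = poly (map_poly to_ac (1 + p * s)) t" by simp
      then show False unfolding hom mul using ev_a root by simp
    qed
    moreover have "Polynomial.degree a < ?r" if "a \<noteq> 0"
      using that coeff_a leading_coeff_neq_0 by metis
    ultimately have "a = 0" using dvd_imp_degree_le not_le by blast
    then have "f j = g j" if "j < ?r" for j using coeff_a[of j] that by simp
    then show "f = g" using fg by (intro PiE_ext) auto
  qed
  moreover have "ev ` ({..<?r} \<rightarrow>\<^sub>E UNIV) \<subseteq> Fq_ext k"
  proof clarify
    fix f
    have "(to_ac (f i) * t ^ i) ^ (CARD('k) ^ k) = to_ac (f i) * t ^ i" for i
      using t by (simp add: power_mult_distrib to_ac_power_CARD Fq_ext_def
          power_mult[symmetric] mult.commute[of i] power_mult[of t "CARD('k) ^ k"])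
    then show "ev f \<in> Fq_ext k" by (simp add: Fq_ext_def ev_def frobenius_sum)
  qed
  moreover have "finite (Fq_ext k :: 'k alg_closure set)"
    using card_Fq_ext[OF k, where 'k = 'k] CARD_power_pos[where 'k = 'k, of k] card_ge_0_finite by metis
  ultimately have "card ({..<?r} \<rightarrow>\<^sub>E (UNIV :: 'k set)) \<le> card (Fq_ext k :: 'k alg_closure set)"
    by (rule card_inj_on_le)
  then have "CARD('k) ^ ?r \<le> CARD('k) ^ k"
    by (simp add: card_PiE card_Fq_ext[OF k])
  then show ?thesis using CARD_gt_1[where 'k = 'k] by simp
qed

section \<open>The Drinfeld module \<open>\<phi>\<^sub>T = t + \<tau>\<^sup>n\<close>\<close>

locale drinfeld_module =
  fixes \<phi> :: "'k::finite_field poly \<Rightarrow> 'k alg_closure poly" and n r :: nat and t :: "'k alg_closure"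
  assumes n_pos: "n > 0"
    and hom: "Fq_algebra_hom r \<phi>"
    and \<phi>_T: "\<phi> [:0, 1:] = [:t:] + Polynomial.monom 1 n"
begin

definition action :: "'k poly \<Rightarrow> 'k alg_closure \<Rightarrow> 'k alg_closure"
  where "action a x = twisted_apply (\<phi> a) x"

lemma \<phi>_add: "\<phi> (a + b) = \<phi> a + \<phi> b"
  and \<phi>_mult: "\<phi> (a * b) = twisted_mult (\<phi> a) (\<phi> b)"
  and \<phi>_coeff: "Polynomial.coeff (\<phi> a) i \<in> Fq_ext r"
  using hom unfolding Fq_algebra_hom_def ring_hom_def ring_of_type_algebra_def twisted_ring_def
  by (auto simp: Pi_iff)

lemma action_const: "action [:c:] x = to_ac c * x"
  using hom by (simp add: action_def Fq_algebra_hom_def twisted_apply_const)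

lemma action_T: "action [:0, 1:] x = t * x + x ^ (CARD('k) ^ n)"
  by (simp add: action_def \<phi>_T twisted_apply_add twisted_apply_const twisted_apply_monom)

lemma action_add: "action (a + b) x = action a x + action b x"
  by (simp add: action_def \<phi>_add twisted_apply_add)

lemma action_mult: "action (a * b) x = action a (action b x)"
  by (simp add: action_def \<phi>_mult twisted_apply_mult)

sublocale scalar_module action
proof
  show "action a (x + y) = action a x + action a y" for a x y
    by (simp add: action_def twisted_apply_arg_add)
  show "action 1 x = x" for x using action_const[of 1 x] by (simp add: one_pCons)
qed (simp_all add: action_add action_mult)

(* As a rewrite rule it would undo action_mult and loop with it. *)
declare scale_scale [simp del]

lemma pCons_eq: "pCons c a = [:c:] + [:0, 1:] * a" for c :: 'k
  by simp

lemma action_pCons: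
  "action (pCons c a) x = to_ac c * x + (t * action a x + action a x ^ (CARD('k) ^ n))"
  by (subst pCons_eq) (simp only: action_add action_mult action_const action_T)

text \<open>
  Constants and \<open>\<tau>\<^sup>n\<close> are \<open>F_{q^n}\<close>-linear, and \<open>\<phi>\<^sub>a\<close> is built from them.
\<close>

lemma action_Fq_ext_linear:
  assumes "z \<in> Fq_ext n"
  shows "action a (z * x) = z * action a x"
proof (induction a)
  case (pCons c a)
  then show ?case
    using assms by (simp add: action_pCons power_mult_distrib Fq_ext_def algebra_simps)
qed simp

lemma action_frobenius:
  "action a (x ^ (CARD('k) ^ (r * m))) = action a x ^ (CARD('k) ^ (r * m))"
  unfolding action_def by (rule twisted_apply_frobenius) (rule \<phi>_coeff)

text \<open>
  As an ordinary polynomial function, \<open>\<phi>\<^sub>a\<close> is nonzero; this gives finiteness of the torsion.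
\<close>

lemma action_polynomial:
  assumes "a \<noteq> 0"
  shows "\<exists>P. Polynomial.degree P = CARD('k) ^ (n * Polynomial.degree a) \<and> (\<forall>x. poly P x = action a x)"
  using assms
proof (induction a)
  case (pCons c a)
  show ?case
  proof (cases "a = 0")
    case True
    then have "Polynomial.degree [:0, to_ac c:] = CARD('k) ^ (n * Polynomial.degree (pCons c a)) \<and>
       (\<forall>x. poly [:0, to_ac c:] x = action (pCons c a) x)"
      using pCons.hyps CARD_power_pos[where 'k = 'k] by (simp add: action_pCons power_0_left mult.commute)
    then show ?thesis by blast
  next
    case False
    then obtain P where P: "Polynomial.degree P = CARD('k) ^ (n * Polynomial.degree a)"
      "\<And>x. poly P x = action a x" using pCons.IH by blast
    let ?q = "CARD('k) ^ n"
    let ?P = "([:0, to_ac c:] + Polynomial.smult t P) + P ^ ?q"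
    have dP: "Polynomial.degree P \<ge> 1" using P(1) CARD_power_pos[where 'k = 'k] by (simp add: Suc_le_eq)
    have q: "?q > 1" using CARD_gt_1[where 'k = 'k] n_pos by (rule one_less_power)
    have dq: "Polynomial.degree (P ^ ?q) = ?q * Polynomial.degree P"
      using dP by (intro degree_power_eq) auto
    have "Polynomial.degree ([:0, to_ac c:] + Polynomial.smult t P) \<le> Polynomial.degree P"
      using dP by (intro degree_add_le) (auto intro: order_trans[OF degree_pCons_le])
    also have "\<dots> < Polynomial.degree (P ^ ?q)" using dq q dP by simp
    finally have "Polynomial.degree ?P = CARD('k) ^ (n * Polynomial.degree (pCons c a))"
      using False by (simp add: degree_add_eq_right dq P(1) power_add)
    moreover have "poly ?P x = action (pCons c a) x" for x
      by (simp add: P(2) action_pCons algebra_simps)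
    ultimately show ?thesis by blast
  qed
qed simp

lemma finite_torsion:
  assumes "a \<noteq> 0"
  shows "finite (torsion \<phi> a)"
proof -
  obtain P where P: "Polynomial.degree P = CARD('k) ^ (n * Polynomial.degree a)"
      "\<And>x. poly P x = action a x" using action_polynomial[OF assms] by blast
  then have "P \<noteq> 0" using CARD_power_pos[where 'k = 'k, of "n * Polynomial.degree a"] by auto
  moreover have "torsion \<phi> a = {x. poly P x = 0}" by (simp add: P(2) torsion_def action_def)
  ultimately show ?thesis by (simp add: poly_roots_finite)
qed

lemma subspace_torsion: "subspace (torsion \<phi> a)"
proof (rule subspaceI)
  show "action c x \<in> torsion \<phi> a" if "x \<in> torsion \<phi> a" for c x
    using that scale_left_commute[of a c x] by (simp add: torsion_def action_def[symmetric])
qed (auto simp: torsion_def action_def[symmetric] scale_right_distrib)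

text \<open>
  This expresses \<open>\<phi>\<^sub>a = a(\<phi>\<^sub>T)\<close>, with the coefficients of \<open>a\<close> read in the algebraic closure.
\<close>

lemma action_map_poly:
  "coeff_pairing (\<lambda>j. action (Polynomial.monom 1 j) x) (map_poly to_ac a) = action a x"
proof (induction a arbitrary: x)
  case (pCons c a)
  have "action (Polynomial.monom 1 (Suc j)) x = action (Polynomial.monom 1 j) (action [:0, 1:] x)" for j
    by (simp add: action_mult[symmetric] monom_Suc mult.commute[of "Polynomial.monom 1 j"])
  then have "coeff_pairing (\<lambda>j. action (Polynomial.monom 1 j) x) (map_poly to_ac (pCons c a)) =
      to_ac c * x + action a (action [:0, 1:] x)"
    using pCons by (simp add: map_poly_pCons coeff_pairing_pCons monom_0 one_pCons[symmetric])
  also have "\<dots> = action ([:c:] + a * [:0, 1:]) x"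
    by (simp only: action_add action_mult action_const)
  also have "[:c:] + a * [:0, 1:] = pCons c a" by (simp add: mult.commute)
  finally show ?case .
qed simp

text \<open>
  Appending the factor \<open>T - s\<close> with \<open>s = t^(q^(nk))\<close> replaces the value at \<open>x\<close> by the value at \<open>\<phi>\<^sub>T(x)\<close>
  minus \<open>s\<close> times the value at \<open>x\<close>. By induction this is \<open>\<tau>^(nk)(t x + \<tau>\<^sup>n x) - s \<tau>^(nk)(x)\<close>, where
  the terms with \<open>s\<close> cancel. Generalizing over \<open>x\<close> avoids commuting \<open>\<tau>\<close> past coefficients.
\<close>

lemma frobenius_power_pairing:
  "coeff_pairing (\<lambda>j. action (Polynomial.monom 1 j) x) (\<Prod>i<k. [:- (t ^ (CARD('k) ^ (n * i))), 1:])
     = x ^ (CARD('k) ^ (n * k))"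
proof (induction k arbitrary: x)
  case 0
  then show ?case by (simp add: one_pCons coeff_pairing_pCons monom_0)
      (simp add: one_pCons[symmetric])
next
  case (Suc k)
  define G where "G = (\<Prod>i<k. [:- (t ^ (CARD('k) ^ (n * i))), 1:])"
  let ?s = "t ^ (CARD('k) ^ (n * k))" and ?w = "\<lambda>j. action (Polynomial.monom 1 j) x"
  have shift: "?w (Suc j) = action (Polynomial.monom 1 j) (action [:0, 1:] x)" for j
    by (simp add: action_mult[symmetric] monom_Suc mult.commute[of "Polynomial.monom 1 j"])
  have "(\<Prod>i<Suc k. [:- (t ^ (CARD('k) ^ (n * i))), 1:]) = pCons 0 G + Polynomial.smult (- ?s) G"
    by (simp add: G_def mult.commute)
  then have "coeff_pairing ?w (\<Prod>i<Suc k. [:- (t ^ (CARD('k) ^ (n * i))), 1:]) =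
      coeff_pairing (\<lambda>j. ?w (Suc j)) G - ?s * coeff_pairing ?w G"
    by (simp only: coeff_pairing_add coeff_pairing_smult coeff_pairing_pCons) simp
  also have "\<dots> = (action [:0, 1:] x) ^ (CARD('k) ^ (n * k)) - ?s * x ^ (CARD('k) ^ (n * k))"
    unfolding shift using Suc by (simp add: G_def)
  also have "\<dots> = x ^ (CARD('k) ^ (n * Suc k))"
    by (simp only: action_T frobenius_add power_mult_distrib frobenius_frobenius mult_Suc_right) simp
  finally show ?case .
qed

text \<open>
  This is \<open>\<phi>\<^sub>p = \<pi>\<^sup>n\<close>. Since \<open>n\<close> is prime to \<open>r\<close>, the elements \<open>t^(q^(ni))\<close> with \<open>i < r\<close> are pairwise
  distinct: equality of two of them would place \<open>t\<close> in a field \<open>F_{q^k}\<close> with \<open>0 < k < r\<close>. They are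
  therefore all the roots of \<open>p\<close>, and \<open>p\<close> is the product that occurs in \<open>frobenius_power_pairing\<close>.
\<close>

lemma action_characteristic:
  assumes "Polynomial.lead_coeff p = 1" "Factorial_Ring.irreducible p" "Polynomial.degree p = r"
    "coprime n r" "t \<in> Fq_ext r" "poly (map_poly to_ac p) t = 0"
  shows "action p x = x ^ (CARD('k) ^ (n * r))"
proof -
  let ?root = "\<lambda>i. t ^ (CARD('k) ^ (n * i))"
  let ?G = "\<Prod>i<r. [:- ?root i, 1:]"
  let ?P = "map_poly to_ac p"
  have r: "r > 0"
  proof (rule ccontr)
    assume "\<not> r > 0"
    then obtain c where "p = [:c:]" using assms(3) by (auto elim: degree_eq_zeroE)
    then have "p = 1" using assms(1) by (simp add: one_pCons)
    then show False using assms(2) by simp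
  qed
  have inj: "inj_on ?root {..<r}"
  proof -
    have "?root i \<noteq> ?root j" if ij: "i < j" "j < r" for i j
    proof
      assume e: "?root i = ?root j"
      have "n * i + n * (j - i) = n * j"
        using ij by (metis add_mult_distrib2 le_add_diff_inverse less_imp_le)
      then have "?root j = (t ^ (CARD('k) ^ (n * (j - i)))) ^ (CARD('k) ^ (n * i))"
        by (metis frobenius_frobenius add.commute)
      then have "t = t ^ (CARD('k) ^ (n * (j - i)))"
        using e frobenius_inj[of t "n * i"] by simp
      also have "\<dots> = t ^ (CARD('k) ^ (n * (j - i) mod r))"
        by (rule Fq_ext_frobenius_mod[OF assms(5)])
      finally have "t \<in> Fq_ext (n * (j - i) mod r)" by (simp add: Fq_ext_def)
      moreover have "\<not> r dvd n * (j - i)"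
        using assms(4) ij coprime_dvd_mult_right_iff[of r n "j - i"]
        by (auto simp: coprime_commute dest: dvd_imp_le)
      then have "n * (j - i) mod r > 0" by (simp add: dvd_eq_mod_eq_0)
      ultimately have "r \<le> n * (j - i) mod r"
        using root_in_Fq_ext_degree_le[OF assms(2,6)] assms(3) by blast
      then show False using mod_less_divisor[OF r, of "n * (j - i)"] by linarith
    qed
    then show ?thesis by (intro inj_onI) (metis lessThan_iff linorder_neqE_nat)
  qed
  have root: "poly ?P (?root i) = 0" for i
  proof -
    have "(to_ac c * t ^ j) ^ (CARD('k) ^ (n * i)) = to_ac c * ?root i ^ j" for c :: 'k and j
      unfolding power_mult_distrib to_ac_power_CARD power_mult[symmetric]
      by (simp only: mult.commute)
    then have "poly ?P (?root i) = (poly ?P t) ^ (CARD('k) ^ (n * i))"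
      by (simp add: poly_altdef frobenius_sum coeff_map_poly)
    then show ?thesis using assms(6) CARD_power_pos[where 'k = 'k] by (simp add: power_0_left)
  qed
  have degG: "Polynomial.degree ?G = r"
    by (subst degree_prod_eq_sum_degree) auto
  have "?G = ?P"
  proof (rule poly_eqI_degree_lead_coeff[where n = r and A = "?root ` {..<r}"])
    show "Polynomial.coeff ?G r = Polynomial.coeff ?P r"
      using lead_coeff_prod[of "\<lambda>i. [:- ?root i, 1:]" "{..<r}"] degG assms(1,3)
      by (simp add: coeff_map_poly)
    show "r \<le> card (?root ` {..<r})" using inj by (simp add: card_image)
    show "Polynomial.degree ?P \<le> r" using assms(3) by (simp add: degree_map_poly)
    show "poly ?G z = poly ?P z" if "z \<in> ?root ` {..<r}" for z
      using that root by (auto simp: poly_prod)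
  qed (simp add: degG)
  then show ?thesis using action_map_poly[of x p] frobenius_power_pairing[of x r] by simp
qed

lemma action_zero_or_invertible:
  assumes p: "Factorial_Ring.irreducible p"
  shows "(\<forall>x\<in>torsion \<phi> p. action a x = 0) \<or> (\<exists>b. \<forall>x\<in>torsion \<phi> p. action b (action a x) = x)"
proof (cases "p dvd a")
  case True
  then obtain s where "a = s * p" by (metis dvd_def mult.commute)
  then show ?thesis by (simp add: action_mult torsion_def action_def[of p, symmetric])
next
  case False
  then obtain b where "p dvd b * a - 1" using irreducible_bezout[OF p] by blast
  then obtain s where "b * a = 1 + s * p" by (metis dvd_def mult.commute add.commute diff_add_cancel)
  then have "action b (action a x) = action (1 + s * p) x" for x by (simp add: action_mult[symmetric])
  then have "action b (action a x) = x" if "x \<in> torsion \<phi> p" for x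
    using that by (simp only: action_add action_mult scale_one)
      (simp add: torsion_def action_def[of p, symmetric])
  then show ?thesis by blast
qed

text \<open>
  Multiplication by \<open>z \<in> F_{q^n}\<close> provides the required endomorphisms. A sum \<open>s\<close> of twists of \<open>z\<close> is
  nonzero for some \<open>z\<close>. It is fixed by the \<open>q^(rm)\<close>-power map, as the last twist wraps around to \<open>z\<close>,
  so \<open>z / s\<close> has trace \<open>1\<close>.
\<close>

lemma relative_trace_module_torsion:
  assumes p: "Factorial_Ring.irreducible p"
    and p0: "\<And>x. action p0 x = x ^ (CARD('k) ^ (n * r))"
    and nr: "coprime n r" and m: "m dvd n"
  shows "relative_trace_module action (torsion \<phi> p) (\<lambda>x. x ^ (CARD('k) ^ (r * m))) (n div m)"
proof -
  let ?V = "torsion \<phi> p" and ?S = "\<lambda>x :: 'k alg_closure. x ^ (CARD('k) ^ (r * m))"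
  define d where "d = n div m"
  have m_pos: "m > 0" using m n_pos by (metis dvd_0_left gr0I less_irrefl)
  have d: "m * d = n" using m by (simp add: d_def)
  have d_pos: "d > 0" using d n_pos by (metis gr0I mult_0_right less_irrefl)
  have rmd: "r * m * d = n * r" using d by (metis mult.assoc mult.commute)
  have S_pow: "(?S ^^ i) x = x ^ (CARD('k) ^ (r * m * i))" for i x
  proof (induction i)
    case (Suc i)
    have "(?S ^^ Suc i) x = (x ^ (CARD('k) ^ (r * m * i))) ^ (CARD('k) ^ (r * m))" using Suc by simp
    also have "\<dots> = x ^ (CARD('k) ^ (r * m * Suc i))"
      by (simp only: frobenius_frobenius mult_Suc_right add.commute)
    finally show ?case .
  qed simp
  interpret twisted_operator_module action ?V ?S d
  proof
    show "finite ?V" using finite_torsion p by (auto simp: Factorial_Ring.irreducible_def)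
    show "subspace ?V" by (rule subspace_torsion)
    show "(\<forall>x\<in>?V. action a x = 0) \<or> (\<exists>b. \<forall>x\<in>?V. action b (action a x) = x)" for a
      by (rule action_zero_or_invertible[OF p])
    show "linear_on ?V ?V ?S"
    proof (rule linear_onI)
      show "?S x \<in> ?V" if "x \<in> ?V" for x
        using that action_frobenius[of p x m] CARD_power_pos[where 'k = 'k, of "r * m"]
        by (simp add: torsion_def action_def power_0_left)
    qed (simp_all add: frobenius_add action_frobenius)
    show "inj_on ?S ?V" by (rule inj_onI) (rule frobenius_inj)
    show "\<exists>c. \<forall>x\<in>?V. (?S ^^ d) x = action c x"
    proof (intro exI ballI)
      show "(?S ^^ d) x = action p0 x" for x by (simp only: S_pow p0 rmd)
    qed
  qed (rule d_pos)
  \<comment> \<open>On \<open>F_{q^n}\<close> only the exponents modulo \<open>n\<close> matter; independence requires these to be distinct.\<close>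
  define k where "k i = r * m * i mod n" for i
  have k_less: "k i < n" for i using n_pos by (simp add: k_def)
  have k_inj: "inj_on k {..<d}"
  proof -
    have "k i \<noteq> k j" if ij: "i < j" "j < d" for i j
    proof
      assume "k i = k j"
      then have "n dvd r * m * j - r * m * i"
        using ij unfolding k_def by (metis mod_eq_dvd_iff_nat less_imp_le mult_le_mono2)
      then have "n dvd r * (m * (j - i))" by (simp add: diff_mult_distrib2 mult.assoc)
      then have "n dvd m * (j - i)" using nr by (simp add: coprime_dvd_mult_right_iff)
      moreover have "m * (j - i) > 0" using ij m_pos by simp
      moreover have "m * (j - i) < m * d" using ij m_pos by (intro mult_strict_left_mono) auto
      ultimately show False using d dvd_imp_le by fastforce
    qed
    then show ?thesis by (intro inj_onI) (metis lessThan_iff linorder_neqE_nat)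
  qed
  have k_pow: "z ^ (CARD('k) ^ k i) = z ^ (CARD('k) ^ (r * m * i))"
    if "z \<in> (Fq_ext n :: 'k alg_closure set)" for z i
    using Fq_ext_frobenius_mod[OF that, of "r * m * i"] by (simp add: k_def)
  have scalar_linear: "linear_on ?V ?V (\<lambda>x. z * x)" if z: "z \<in> Fq_ext n" for z
  proof (rule linear_onI)
    show "z * x \<in> ?V" if "x \<in> ?V" for x
      using that action_Fq_ext_linear[OF z, of p x] by (simp add: torsion_def action_def)
  qed (simp_all add: distrib_left action_Fq_ext_linear[OF z])
  have twist: "(?S ^^ i) (z * x) = z ^ (CARD('k) ^ (r * m * i)) * (?S ^^ i) x" for z x i
    by (simp add: S_pow power_mult_distrib)
  show ?thesis
    unfolding d_def[symmetric]
  proof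
    obtain z where z: "z \<in> (Fq_ext n :: 'k alg_closure set)" "(\<Sum>i<d. z ^ (CARD('k) ^ k i)) \<noteq> 0"
      using frobenius_twists_independent[OF n_pos k_inj k_less d_pos, of "\<lambda>_. 1 :: 'k alg_closure"]
      by auto
    define s where "s = (\<Sum>i<d. z ^ (CARD('k) ^ (r * m * i)))"
    have "s \<noteq> 0" using z by (simp add: s_def k_pow[OF z(1)])
    have "s \<in> Fq_ext n" unfolding s_def by (intro Fq_ext_sum Fq_ext_power_CARD z)
    have "s ^ (CARD('k) ^ (r * m)) = (\<Sum>i<d. z ^ (CARD('k) ^ (r * m * Suc i)))"
      unfolding s_def frobenius_sum frobenius_frobenius by (simp only: mult_Suc_right add.commute)
    also have "\<dots> = (\<Sum>i<Suc d. z ^ (CARD('k) ^ (r * m * i))) - z"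
      by (subst sum.lessThan_Suc_shift) simp
    also have "\<dots> = s + z ^ (CARD('k) ^ (n * r)) - z"
      by (simp add: s_def rmd)
    also have "\<dots> = s" using Fq_ext_frobenius_mult[OF z(1)] by simp
    finally have "s \<in> Fq_ext (r * m)" by (simp add: Fq_ext_def)
    note s_fixed = Fq_ext_frobenius_mult[OF this]
    have "(\<Sum>i<d. (z / s) ^ (CARD('k) ^ (r * m * i))) = s / s"
      unfolding power_divide s_fixed sum_divide_distrib[symmetric] by (simp add: s_def)
    then have tr: "(\<Sum>i<d. (z / s) ^ (CARD('k) ^ (r * m * i))) = 1" using \<open>s \<noteq> 0\<close> by simp
    have "relative_trace (\<lambda>x. z / s * x) x = x" if "x \<in> ?V" for x
      unfolding relative_trace_def twist S_pow_S_inv_pow[OF that] sum_distrib_right[symmetric] tr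
      by simp
    then show "\<exists>e. linear_on ?V ?V e \<and> (\<forall>x\<in>?V. relative_trace e x = x)"
      using scalar_linear[OF Fq_ext_divide[OF z(1) \<open>s \<in> Fq_ext n\<close>]] by blast
  next
    fix c :: "nat \<Rightarrow> 'k alg_closure"
    assume "c 0 \<noteq> 0"
    then have "(?S ^^ 0) (c 0) \<noteq> 0" by simp
    from frobenius_twists_independent[where c = "\<lambda>i. (?S ^^ i) (c i)", OF n_pos k_inj k_less d_pos this]
    obtain z where z: "z \<in> (Fq_ext n :: 'k alg_closure set)"
      "(\<Sum>i<d. (?S ^^ i) (c i) * z ^ (CARD('k) ^ k i)) \<noteq> 0" by blast
    then have "(\<Sum>i<d. (?S ^^ i) (z * c i)) \<noteq> 0"
      unfolding k_pow[OF z(1)] twist by (simp add: mult.commute)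
    then show "\<exists>e. linear_on ?V ?V e \<and> (\<Sum>i<d. (?S ^^ i) (e (c i))) \<noteq> 0"
      using scalar_linear[OF z(1)] by blast
  qed
qed

end

section \<open>Annihilators and common zeros\<close>

context relative_trace_module
begin

text \<open>
  Extensional representatives, so that two maps are equal as soon as they agree on \<open>V\<close>.
\<close>

definition equivariant_maps :: "('b \<Rightarrow> 'b) set"
  where "equivariant_maps = {f \<in> extensional V. equivariant V f}"

lemma restrict_equivariant_maps: "equivariant V f \<Longrightarrow> restrict f V \<in> equivariant_maps"
  using linear_onD(1)[OF linear_S] subspace_add[OF subspace_V] subspace_scale[OF subspace_V]
  by (simp add: equivariant_maps_def equivariant_def linear_on_def)

lemma finite_equivariant_maps: "finite equivariant_maps"
proof (rule finite_subset)
  show "equivariant_maps \<subseteq> V \<rightarrow>\<^sub>E V"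
    by (auto simp: equivariant_maps_def equivariant_def linear_on_def PiE_def)
qed (simp add: finite_PiE finite_V)

lemma common_zeros_of_annihilator:
  assumes W: "stable W"
  shows "{v \<in> V. \<forall>f\<in>equivariant_maps. (\<forall>w\<in>W. f w = 0) \<longrightarrow> f v = 0} = W"
proof
  show "W \<subseteq> {v \<in> V. \<forall>f\<in>equivariant_maps. (\<forall>w\<in>W. f w = 0) \<longrightarrow> f v = 0}"
    using W by (auto simp: stable_def)
  show "{v \<in> V. \<forall>f\<in>equivariant_maps. (\<forall>w\<in>W. f w = 0) \<longrightarrow> f v = 0} \<subseteq> W"
  proof clarify
    fix v assume v: "v \<in> V" and h: "\<forall>f\<in>equivariant_maps. (\<forall>w\<in>W. f w = 0) \<longrightarrow> f v = 0"
    show "v \<in> W"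
    proof (rule ccontr)
      assume "v \<notin> W"
      then obtain f where f: "equivariant V f" "\<And>x. x \<in> W \<Longrightarrow> f x = 0" "f v \<noteq> 0"
        using stable_subspace_closed[OF W v] by metis
      have "\<forall>w\<in>W. restrict f V w = 0" using f(2) W by (auto simp: stable_def)
      then have "restrict f V v = 0" using h restrict_equivariant_maps[OF f(1)] by blast
      then show False using f(3) v by simp
    qed
  qed
qed

lemma stable_common_zeros:
  assumes "C \<subseteq> equivariant_maps"
  shows "stable {v \<in> V. \<forall>f\<in>C. f v = 0}"
proof -
  have C: "linear_on V V f" "\<And>x. x \<in> V \<Longrightarrow> f (S x) = S (f x)" if "f \<in> C" for f
    using assms that by (auto simp: equivariant_maps_def equivariant_def)
  show ?thesis
    unfolding stable_def
  proof (intro conjI subspaceI)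
    show "S ` {v \<in> V. \<forall>f\<in>C. f v = 0} \<subseteq> {v \<in> V. \<forall>f\<in>C. f v = 0}"
    proof clarify
      fix x assume x: "x \<in> V" "\<forall>f\<in>C. f x = 0"
      have "f (S x) = 0" if "f \<in> C" for f
        using C(2)[OF that x(1)] bspec[OF x(2) that] linear_on_zero[OF linear_S subspace_V] by simp
      then show "S x \<in> V \<and> (\<forall>f\<in>C. f (S x) = 0)" using linear_onD(1)[OF linear_S x(1)] by blast
    qed
  next
    show "0 \<in> {v \<in> V. \<forall>f\<in>C. f v = 0}"
      using linear_on_zero[OF C(1) subspace_V] subspace_0[OF subspace_V] by simp
    show "x + y \<in> {v \<in> V. \<forall>f\<in>C. f v = 0}"
      if "x \<in> {v \<in> V. \<forall>f\<in>C. f v = 0}" "y \<in> {v \<in> V. \<forall>f\<in>C. f v = 0}" for x y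
    proof -
      have "f (x + y) = 0" if f: "f \<in> C" for f
        using linear_onD(2)[OF C(1)[OF f], of x y] that \<open>x \<in> _\<close> \<open>y \<in> _\<close> by fastforce
      then show ?thesis using that subspace_add[OF subspace_V] by blast
    qed
    show "a \<star> x \<in> {v \<in> V. \<forall>f\<in>C. f v = 0}" if "x \<in> {v \<in> V. \<forall>f\<in>C. f v = 0}" for a x
    proof -
      have "f (a \<star> x) = 0" if f: "f \<in> C" for f
        using linear_onD(3)[OF C(1)[OF f], of x a] that \<open>x \<in> _\<close> by fastforce
      then show ?thesis using that subspace_scale[OF subspace_V] by blast
    qed
  qed auto
qed

lemma annihilator_of_common_zeros:
  assumes C: "C \<subseteq> equivariant_maps"
    and zero: "(\<lambda>x\<in>V. 0) \<in> C"
    and add: "\<And>f g. f \<in> C \<Longrightarrow> g \<in> C \<Longrightarrow> (\<lambda>x\<in>V. f x + g x) \<in> C"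
    and mult: "\<And>h f. h \<in> equivariant_maps \<Longrightarrow> f \<in> C \<Longrightarrow> compose V h f \<in> C"
    and g: "g \<in> equivariant_maps"
    and g_zero: "\<And>x. x \<in> V \<Longrightarrow> (\<And>f. f \<in> C \<Longrightarrow> f x = 0) \<Longrightarrow> g x = 0"
  shows "g \<in> C"
proof -
  have finC: "finite C" using C finite_equivariant_maps by (rule finite_subset)
  have "\<exists>h. (\<forall>f\<in>C. equivariant V (h f)) \<and> (\<forall>x\<in>V. g x = (\<Sum>f\<in>C. h f (f x)))"
    by (rule equivariant_combination[OF finC _ stable_V])
      (use C g g_zero in \<open>auto simp: equivariant_maps_def\<close>)
  then obtain h where h: "\<And>f. f \<in> C \<Longrightarrow> equivariant V (h f)"
    "\<And>x. x \<in> V \<Longrightarrow> g x = (\<Sum>f\<in>C. h f (f x))" by blast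
  have "(\<lambda>x\<in>V. \<Sum>f\<in>F. h f (f x)) \<in> C" if "finite F" "F \<subseteq> C" for F
    using that
  proof (induction F rule: finite_induct)
    case empty
    show ?case using zero by (simp only: sum.empty)
  next
    case (insert f F)
    have fC: "f \<in> C" and FC: "F \<subseteq> C" using insert.prems by auto
    have "f x \<in> V" if "x \<in> V" for x
      using that fC C by (auto simp: equivariant_maps_def equivariant_def linear_on_def)
    then have "(\<lambda>x\<in>V. \<Sum>f\<in>insert f F. h f (f x)) =
        (\<lambda>x\<in>V. compose V (restrict (h f) V) f x + (\<lambda>x\<in>V. \<Sum>f\<in>F. h f (f x)) x)"
      using insert.hyps by (auto simp: compose_def restrict_def)
    then show ?case
      using add[OF mult[OF restrict_equivariant_maps[OF h(1)[OF fC]] fC] insert.IH[OF FC]]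
      by (simp only:)
  qed
  from this[OF finC subset_refl] have "(\<lambda>x\<in>V. \<Sum>f\<in>C. h f (f x)) \<in> C" .
  moreover have "g = (\<lambda>x\<in>V. \<Sum>f\<in>C. h f (f x))"
    using g h(2) by (auto simp: equivariant_maps_def extensional_def)
  ultimately show ?thesis by simp
qed

end

section \<open>Translation to rings and modules as records\<close>

text \<open>
  Inverses in a record are given by a definite description. This computes them without first showing
  that the record is a group.
\<close>

lemma m_inv_eqI:
  fixes G (structure)
  assumes "y \<in> carrier G" "x \<otimes> y = \<one>" "y \<otimes> x = \<one>"
    and "\<And>z. z \<in> carrier G \<Longrightarrow> x \<otimes> z = \<one> \<Longrightarrow> z = y"
  shows "inv x = y"
  unfolding m_inv_def by (rule the_equality) (use assms in blast)+

lemma left_ideal_closed: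
  assumes "left_ideal C R"
  shows "C \<subseteq> carrier R" "\<zero>\<^bsub>R\<^esub> \<in> C" "f \<in> C \<Longrightarrow> g \<in> C \<Longrightarrow> f \<oplus>\<^bsub>R\<^esub> g \<in> C"
    "h \<in> carrier R \<Longrightarrow> f \<in> C \<Longrightarrow> h \<otimes>\<^bsub>R\<^esub> f \<in> C"
proof -
  have sub: "subgroup C (add_monoid R)" and
    mult: "\<And>h f. h \<in> carrier R \<Longrightarrow> f \<in> C \<Longrightarrow> h \<otimes>\<^bsub>R\<^esub> f \<in> C"
    using assms unfolding left_ideal_def additive_subgroup_def by blast+
  show "C \<subseteq> carrier R" "\<zero>\<^bsub>R\<^esub> \<in> C" "f \<in> C \<Longrightarrow> g \<in> C \<Longrightarrow> f \<oplus>\<^bsub>R\<^esub> g \<in> C"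
    using subgroup.subset[OF sub] subgroup.one_closed[OF sub] subgroup.m_closed[OF sub, of f g]
    by simp_all
  show "h \<in> carrier R \<Longrightarrow> f \<in> C \<Longrightarrow> h \<otimes>\<^bsub>R\<^esub> f \<in> C" by (rule mult)
qed

context drinfeld_module
begin

lemma torsion_module_fields [simp]:
  "carrier (torsion_module \<phi> p) = torsion \<phi> p" "\<zero>\<^bsub>torsion_module \<phi> p\<^esub> = 0"
  "x \<oplus>\<^bsub>torsion_module \<phi> p\<^esub> y = x + y"
  by (simp_all add: torsion_module_def)

lemma End_ring_fields [simp]:
  "f \<otimes>\<^bsub>End_ring K (torsion_module \<phi> p)\<^esub> g = compose (torsion \<phi> p) f g"
  "\<one>\<^bsub>End_ring K (torsion_module \<phi> p)\<^esub> = (\<lambda>x\<in>torsion \<phi> p. x)"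
  "\<zero>\<^bsub>End_ring K (torsion_module \<phi> p)\<^esub> = (\<lambda>x\<in>torsion \<phi> p. 0)"
  "f \<oplus>\<^bsub>End_ring K (torsion_module \<phi> p)\<^esub> g = (\<lambda>x\<in>torsion \<phi> p. f x + g x)"
  by (simp_all add: End_ring_def)

definition residue_class :: "'k poly \<Rightarrow> 'k poly \<Rightarrow> 'k poly set"
  where "residue_class p a = {s * p + a | s. True}"

lemma carrier_residue_field: "carrier (residue_field p) = range (residue_class p)"
proof -
  have "PIdl\<^bsub>ring_of_type_algebra\<^esub> p = {s * p | s. True}"
    by (simp add: cgenideal_def ring_of_type_algebra_def)
  then have "r_coset (add_monoid ring_of_type_algebra) (PIdl\<^bsub>ring_of_type_algebra\<^esub> p) a =
      residue_class p a" for a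
    by (auto simp: r_coset_def residue_class_def ring_of_type_algebra_def)
  moreover have "carrier (residue_field p) =
      range (r_coset (add_monoid ring_of_type_algebra) (PIdl\<^bsub>ring_of_type_algebra\<^esub> p))"
    by (auto simp: residue_field_def FactRing_def A_RCOSETS_def RCOSETS_def ring_of_type_algebra_def)
  ultimately show ?thesis by simp
qed

lemma smult_residue_class:
  assumes "v \<in> torsion \<phi> p"
  shows "residue_class p a \<odot>\<^bsub>torsion_module \<phi> p\<^esub> v = action a v"
proof -
  have "(\<lambda>a. twisted_apply (\<phi> a) v) ` residue_class p a = (\<lambda>s. action (s * p + a) v) ` UNIV"
    by (auto simp: residue_class_def action_def)
  also have "\<dots> = {action a v}"
    using assms by (auto simp: action_add action_mult torsion_def action_def[of p, symmetric])
  finally show ?thesis by (simp add: torsion_module_def)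
qed

lemma carrier_End_ring:
  "carrier (End_ring (residue_field p) (torsion_module \<phi> p)) =
     {f \<in> extensional (torsion \<phi> p). linear_on (torsion \<phi> p) (torsion \<phi> p) f}"
  unfolding End_ring_def carrier_residue_field torsion_module_fields
proof (simp, intro Collect_cong iffI)
  fix f
  assume f: "f \<in> torsion \<phi> p \<rightarrow>\<^sub>E torsion \<phi> p \<and>
    (\<forall>x\<in>torsion \<phi> p. \<forall>y\<in>torsion \<phi> p. f (x + y) = f x + f y) \<and>
    (\<forall>a. \<forall>x\<in>torsion \<phi> p. f (residue_class p a \<odot>\<^bsub>torsion_module \<phi> p\<^esub> x) =
      residue_class p a \<odot>\<^bsub>torsion_module \<phi> p\<^esub> f x)"
  then have "f (action a x) = action a (f x)" if "x \<in> torsion \<phi> p" for a x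
    using that PiE_mem[of f "torsion \<phi> p" "\<lambda>_. torsion \<phi> p" x] by (metis smult_residue_class)
  then show "f \<in> extensional (torsion \<phi> p) \<and> linear_on (torsion \<phi> p) (torsion \<phi> p) f"
    using f by (auto simp: linear_on_def PiE_def)
next
  fix f
  assume f: "f \<in> extensional (torsion \<phi> p) \<and> linear_on (torsion \<phi> p) (torsion \<phi> p) f"
  then show "f \<in> torsion \<phi> p \<rightarrow>\<^sub>E torsion \<phi> p \<and>
    (\<forall>x\<in>torsion \<phi> p. \<forall>y\<in>torsion \<phi> p. f (x + y) = f x + f y) \<and>
    (\<forall>a. \<forall>x\<in>torsion \<phi> p. f (residue_class p a \<odot>\<^bsub>torsion_module \<phi> p\<^esub> x) =
      residue_class p a \<odot>\<^bsub>torsion_module \<phi> p\<^esub> f x)"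
    by (simp add: linear_on_def PiE_def Pi_def smult_residue_class)
qed

lemma scalar_ops_torsion:
  "scalar_ops (residue_field p) (torsion_module \<phi> p) = range (\<lambda>a. \<lambda>x\<in>torsion \<phi> p. action a x)"
  unfolding scalar_ops_def carrier_residue_field image_image torsion_module_fields
  by (intro image_cong refl restrict_ext) (rule smult_residue_class)

lemma End_ring_minus:
  assumes h: "h \<in> carrier (End_ring (residue_field p) (torsion_module \<phi> p))"
  shows "\<ominus>\<^bsub>End_ring (residue_field p) (torsion_module \<phi> p)\<^esub> h = (\<lambda>x\<in>torsion \<phi> p. - h x)"
  unfolding a_inv_def
proof (rule m_inv_eqI)
  show "(\<lambda>x\<in>torsion \<phi> p. - h x) \<in> carrier (add_monoid (End_ring (residue_field p) (torsion_module \<phi> p)))"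
    using h subspace_neg[OF subspace_torsion] subspace_add[OF subspace_torsion]
      subspace_scale[OF subspace_torsion]
    by (simp add: carrier_End_ring linear_on_def)
  show "z = (\<lambda>x\<in>torsion \<phi> p. - h x)"
    if z: "z \<in> carrier (add_monoid (End_ring (residue_field p) (torsion_module \<phi> p)))"
      and e: "h \<otimes>\<^bsub>add_monoid (End_ring (residue_field p) (torsion_module \<phi> p))\<^esub> z =
        \<one>\<^bsub>add_monoid (End_ring (residue_field p) (torsion_module \<phi> p))\<^esub>" for z
  proof (rule extensionalityI[of _ "torsion \<phi> p"])
    fix x assume "x \<in> torsion \<phi> p"
    then have "h x + z x = 0" using fun_cong[OF e, of x] by simp
    then show "z x = (\<lambda>x\<in>torsion \<phi> p. - h x) x"
      using \<open>x \<in> torsion \<phi> p\<close> by (simp add: add_eq_0_iff)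
  qed (use z in \<open>simp_all add: carrier_End_ring\<close>)
qed (auto simp: restrict_def)

text \<open>
  Left ideals of \<open>R\<close> are the sets of equivariant maps considered in \<open>annihilator_of_common_zeros\<close>, and
  \<open>R0\<close>-submodules are the stable subspaces considered in \<open>common_zeros_of_annihilator\<close>.
\<close>

lemma torsion_bijections:
  fixes p :: "'k poly" and m :: nat
  assumes rtm: "relative_trace_module action (torsion \<phi> p) (\<lambda>x. x ^ (CARD('k) ^ (r * m))) d"
  defines "M \<equiv> torsion_module \<phi> p"
  defines "R0 \<equiv> adjoin_op (residue_field p) M
    (\<lambda>v\<in>carrier M. twisted_apply (Polynomial.monom 1 r [^]\<^bsub>twisted_ring r\<^esub> m) v)"
  defines "R \<equiv> centralizer (End_ring (residue_field p) M) (carrier R0)"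
  shows "left_ideal C R \<Longrightarrow> submodule (zero_locus M C) R0 (evaluation_module M)"
    and "submodule W R0 (evaluation_module M) \<Longrightarrow> left_ideal (annihilator R M W) R"
    and "left_ideal C R \<Longrightarrow> annihilator R M (zero_locus M C) = C"
    and "submodule W R0 (evaluation_module M) \<Longrightarrow> zero_locus M (annihilator R M W) = W"
proof -
  let ?V = "torsion \<phi> p" and ?S = "\<lambda>x :: 'k alg_closure. x ^ (CARD('k) ^ (r * m))"
  let ?E = "End_ring (residue_field p) M"
  interpret relative_trace_module action ?V ?S d by (rule rtm)
  let ?G = "insert (\<lambda>x\<in>?V. ?S x) (range (\<lambda>a. \<lambda>x\<in>?V. action a x))"
  have R0: "carrier R0 = generate_ring ?E ?G"
    by (simp add: R0_def adjoin_op_def M_def scalar_ops_torsion twisted_ring_pow_monom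
        twisted_apply_monom)
  have E: "carrier ?E = {f \<in> extensional ?V. linear_on ?V ?V f}"
    unfolding M_def by (rule carrier_End_ring)
  have restrict_E: "restrict f ?V \<in> carrier ?E" if "linear_on ?V ?V f" for f
    using that subspace_add[OF subspace_V] subspace_scale[OF subspace_V]
    by (simp add: E linear_on_def)
  \<comment> \<open>Membership in \<open>commuting\<close> passes from the generators of \<open>R0\<close> to all of \<open>R0\<close>. It yields both
    descriptions at once: the centralizer of \<open>R0\<close> is the centralizer of the generators, and stability
    under \<open>S\<close> and the scalars is stability under \<open>R0\<close>.\<close>
  define commuting where "commuting g \<longleftrightarrow> g \<in> carrier ?E \<and> (\<forall>W. stable W \<longrightarrow> g ` W \<subseteq> W) \<and>
      (\<forall>f x. equivariant ?V f \<longrightarrow> x \<in> ?V \<longrightarrow> f (g x) = g (f x))" for g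
  have commutingI: "commuting (restrict g ?V)"
    if g: "linear_on ?V ?V g" "\<And>W x. stable W \<Longrightarrow> x \<in> W \<Longrightarrow> g x \<in> W"
      "\<And>f x. equivariant ?V f \<Longrightarrow> x \<in> ?V \<Longrightarrow> f (g x) = g (f x)" for g
    unfolding commuting_def
  proof (intro conjI allI impI)
    show "restrict g ?V \<in> carrier ?E" by (rule restrict_E[OF g(1)])
    show "restrict g ?V ` W \<subseteq> W" if "stable W" for W
      using g(2)[OF that] that by (auto simp: stable_def)
    show "f (restrict g ?V x) = restrict g ?V (f x)" if "equivariant ?V f" "x \<in> ?V" for f x
      using g(3)[OF that] that linear_onD(1)[of ?V ?V f x] by (simp add: equivariant_def)
  qed
  have commutingD: "linear_on ?V ?V g" "\<And>W x. stable W \<Longrightarrow> x \<in> W \<Longrightarrow> g x \<in> W"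
    "\<And>f x. equivariant ?V f \<Longrightarrow> x \<in> ?V \<Longrightarrow> f (g x) = g (f x)" if "commuting g" for g
    using that unfolding commuting_def E by blast+
  have generated: "commuting g" if "g \<in> generate_ring ?E ?G" for g
    using that
  proof (induction rule: generate_ring.induct)
    case one
    have "commuting (\<lambda>x\<in>?V. x)" by (rule commutingI) (auto simp: linear_on_def)
    then show ?case by (simp only: M_def End_ring_fields)
  next
    case (incl g)
    then consider "g = (\<lambda>x\<in>?V. ?S x)" | a where "g = (\<lambda>x\<in>?V. action a x)" by blast
    then show ?case
    proof cases
      case 1
      have "commuting (\<lambda>x\<in>?V. ?S x)"
        by (rule commutingI) (use linear_S in \<open>auto simp: stable_def equivariant_def\<close>)
      then show ?thesis by (simp only: 1)
    next
      case (2 a)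
      have "linear_on ?V ?V (action a)"
        by (rule linear_onI)
          (auto simp: subspace_scale[OF subspace_V] scale_right_distrib intro: scale_left_commute)
      then have "commuting (\<lambda>x\<in>?V. action a x)"
        by (intro commutingI)
          (auto simp: stable_def equivariant_def linear_onD(3) intro: subspace_scale)
      then show ?thesis by (simp only: 2)
    qed
  next
    case (a_inv h)
    note h = commutingD[OF a_inv.IH]
    have "commuting (\<lambda>x\<in>?V. - h x)"
    proof (rule commutingI)
      show "linear_on ?V ?V (\<lambda>x. - h x)"
        using h(1) subspace_neg[OF subspace_V] by (simp add: linear_on_def)
      show "- h x \<in> W" if "stable W" "x \<in> W" for W x
        using h(2)[OF that] that subspace_neg by (simp add: stable_def)
      show "f (- h x) = - h (f x)" if "equivariant ?V f" "x \<in> ?V" for f x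
        using h(3)[OF that] that linear_on_minus[of ?V ?V f "h x"] subspace_V linear_onD(1)[OF h(1)]
        by (simp add: equivariant_def)
    qed
    moreover have "\<ominus>\<^bsub>?E\<^esub> h = (\<lambda>x\<in>?V. - h x)"
      using a_inv.IH unfolding M_def commuting_def by (intro End_ring_minus) simp
    ultimately show ?case by (simp only:)
  next
    case (eng_add g h)
    note g = commutingD[OF eng_add.IH(1)] and h = commutingD[OF eng_add.IH(2)]
    have "commuting (\<lambda>x\<in>?V. g x + h x)"
    proof (rule commutingI)
      show "linear_on ?V ?V (\<lambda>x. g x + h x)"
        using g(1) h(1) subspace_add[OF subspace_V] by (simp add: linear_on_def scale_right_distrib)
      show "g x + h x \<in> W" if "stable W" "x \<in> W" for W x
        using g(2)[OF that] h(2)[OF that] that subspace_add by (simp add: stable_def)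
      show "f (g x + h x) = g (f x) + h (f x)" if "equivariant ?V f" "x \<in> ?V" for f x
        using g(3)[OF that] h(3)[OF that] that linear_onD(2)[of ?V ?V f "g x" "h x"]
          linear_onD(1)[OF g(1)] linear_onD(1)[OF h(1)] by (simp add: equivariant_def)
    qed
    then show ?case by (simp only: M_def End_ring_fields)
  next
    case (eng_mult g h)
    note g = commutingD[OF eng_mult.IH(1)] and h = commutingD[OF eng_mult.IH(2)]
    have "commuting (\<lambda>x\<in>?V. g (h x))"
    proof (rule commutingI)
      show "linear_on ?V ?V (\<lambda>x. g (h x))" by (rule linear_on_comp[OF h(1) g(1)])
      show "g (h x) \<in> W" if "stable W" "x \<in> W" for W x
        using g(2)[OF that(1) h(2)[OF that]] .
      show "f (g (h x)) = g (h (f x))" if "equivariant ?V f" "x \<in> ?V" for f x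
        using g(3)[OF that(1) linear_onD(1)[OF h(1) that(2)]] h(3)[OF that] by simp
    qed
    then show ?case by (simp only: M_def End_ring_fields compose_def)
  qed
  have carrier_R: "carrier R = equivariant_maps"
  proof
    show "carrier R \<subseteq> equivariant_maps"
    proof
      fix f assume f: "f \<in> carrier R"
      then have fE: "f \<in> extensional ?V" "linear_on ?V ?V f"
        by (auto simp: R_def centralizer_def E)
      have "(\<lambda>x\<in>?V. ?S x) \<in> carrier R0" unfolding R0 by (rule generate_ring.incl) simp
      then have comm: "compose ?V f (\<lambda>x\<in>?V. ?S x) = compose ?V (\<lambda>x\<in>?V. ?S x) f"
        using f by (simp add: R_def centralizer_def M_def)
      have "f (?S x) = ?S (f x)" if "x \<in> ?V" for x
        using fun_cong[OF comm, of x] that linear_onD(1)[OF fE(2) that] by (simp add: compose_eq)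
      then show "f \<in> equivariant_maps" using fE by (simp add: equivariant_maps_def equivariant_def)
    qed
    show "equivariant_maps \<subseteq> carrier R"
    proof
      fix f assume f: "f \<in> equivariant_maps"
      then have fE: "f \<in> extensional ?V" "linear_on ?V ?V f" "equivariant ?V f"
        by (auto simp: equivariant_maps_def equivariant_def)
      have "compose ?V f g = compose ?V g f" if "g \<in> carrier R0" for g
        unfolding compose_def
        by (rule restrict_ext) (use commutingD(3)[OF generated fE(3)] that in \<open>simp add: R0\<close>)
      then show "f \<in> carrier R" using fE by (simp add: R_def centralizer_def E) (simp add: M_def)
    qed
  qed
  have submodule_iff: "submodule W R0 (evaluation_module M) \<longleftrightarrow> stable W" for W
  proof
    assume W: "submodule W R0 (evaluation_module M)"
    have sm: "f w \<in> W" if "f \<in> carrier R0" "w \<in> W" for f w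
      using submodule.smult_closed[OF W that] by (simp add: evaluation_module_def)
    have WV: "W \<subseteq> ?V" and W0: "0 \<in> W" and Wadd: "\<And>x y. x \<in> W \<Longrightarrow> y \<in> W \<Longrightarrow> x + y \<in> W"
      using W by (auto simp: submodule_def subgroup_def evaluation_module_def M_def)
    have S_R0: "(\<lambda>x\<in>?V. ?S x) \<in> carrier R0" and a_R0: "(\<lambda>x\<in>?V. action a x) \<in> carrier R0" for a
      unfolding R0 by (intro generate_ring.incl, blast)+
    have "?S w \<in> W" if "w \<in> W" for w using sm[OF S_R0 that] that WV by auto
    moreover have "action a w \<in> W" if "w \<in> W" for a w using sm[OF a_R0 that] that WV by auto
    ultimately show "stable W"
      unfolding stable_def using WV W0 Wadd by (intro conjI subspaceI) blast+
  next
    assume W: "stable W"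
    then have Wsub: "subspace W" and WV: "W \<subseteq> ?V" by (auto simp: stable_def)
    have inv: "inv\<^bsub>add_monoid (evaluation_module M)\<^esub> x = - x" if "x \<in> W" for x
    proof (rule m_inv_eqI)
      show "- x \<in> carrier (add_monoid (evaluation_module M))"
        using that WV subspace_neg[OF subspace_V] by (auto simp: evaluation_module_def M_def)
      show "z = - x"
        if "x \<otimes>\<^bsub>add_monoid (evaluation_module M)\<^esub> z = \<one>\<^bsub>add_monoid (evaluation_module M)\<^esub>" for z
        using that by (simp add: evaluation_module_def M_def add_eq_0_iff)
    qed (simp_all add: evaluation_module_def M_def)
    show "submodule W R0 (evaluation_module M)"
    proof (intro submodule.intro subgroup.intro submodule_axioms.intro)
      show "f \<odot>\<^bsub>evaluation_module M\<^esub> w \<in> W" if "f \<in> carrier R0" "w \<in> W" for f w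
        using commutingD(2)[OF generated W that(2)] that(1) by (simp add: evaluation_module_def R0)
      show "inv\<^bsub>add_monoid (evaluation_module M)\<^esub> x \<in> W" if "x \<in> W" for x
        unfolding inv[OF that] by (rule subspace_neg[OF Wsub that])
    qed (use WV subspace_0[OF Wsub] subspace_add[OF Wsub] in
        \<open>auto simp: evaluation_module_def M_def\<close>)
  qed
  have ops: "f \<otimes>\<^bsub>R\<^esub> g = compose ?V f g" "\<zero>\<^bsub>R\<^esub> = (\<lambda>x\<in>?V. 0)"
    "f \<oplus>\<^bsub>R\<^esub> g = (\<lambda>x\<in>?V. f x + g x)" for f g
    by (simp_all add: R_def centralizer_def M_def)
  have zero_locus: "zero_locus M C = {v \<in> ?V. \<forall>f\<in>C. f v = 0}" for C
    by (simp add: zero_locus_def M_def)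
  have annihilator: "annihilator R M W = {f \<in> equivariant_maps. \<forall>w\<in>W. f w = 0}" for W
    by (simp add: annihilator_def carrier_R M_def)
  show "submodule (zero_locus M C) R0 (evaluation_module M)" if "left_ideal C R"
    unfolding submodule_iff zero_locus
    by (rule stable_common_zeros[OF left_ideal_closed(1)[OF that, unfolded carrier_R]])
  show "annihilator R M (zero_locus M C) = C" if C: "left_ideal C R"
  proof
    note C' = left_ideal_closed[OF C, unfolded carrier_R ops]
    show "C \<subseteq> annihilator R M (zero_locus M C)"
      using C'(1) by (auto simp: annihilator zero_locus)
    show "annihilator R M (zero_locus M C) \<subseteq> C"
    proof
      fix g assume "g \<in> annihilator R M (zero_locus M C)"
      then have g: "g \<in> equivariant_maps" "\<And>v. v \<in> ?V \<Longrightarrow> (\<And>f. f \<in> C \<Longrightarrow> f v = 0) \<Longrightarrow> g v = 0"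
        unfolding annihilator zero_locus by blast+
      show "g \<in> C"
        by (rule annihilator_of_common_zeros[OF C'(1,2) _ _ g]) (rule C'(3,4); assumption)+
    qed
  qed
  show "zero_locus M (annihilator R M W) = W" if "submodule W R0 (evaluation_module M)"
    using common_zeros_of_annihilator[of W] that
    unfolding submodule_iff annihilator zero_locus by blast
  have W_V: "w \<in> ?V" if "submodule W R0 (evaluation_module M)" "w \<in> W" for w
    using that by (auto simp: submodule_iff stable_def)
  have maps: "linear_on ?V ?V f" "f \<in> extensional ?V"
    "\<And>x. x \<in> ?V \<Longrightarrow> f (?S x) = ?S (f x)" if "f \<in> equivariant_maps" for f
    using that by (auto simp: equivariant_maps_def equivariant_def)
  have add_closed: "(\<lambda>x\<in>?V. f x + g x) \<in> equivariant_maps"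
    if f: "f \<in> equivariant_maps" and g: "g \<in> equivariant_maps" for f g
  proof (rule restrict_equivariant_maps)
    show "equivariant ?V (\<lambda>x. f x + g x)"
      using maps[OF f] maps[OF g] subspace_add[OF subspace_V]
      by (simp add: equivariant_def linear_on_def scale_right_distrib frobenius_add)
  qed
  have minus_closed: "(\<lambda>x\<in>?V. - f x) \<in> equivariant_maps" if f: "f \<in> equivariant_maps" for f
  proof (rule restrict_equivariant_maps)
    show "equivariant ?V (\<lambda>x. - f x)"
      using maps[OF f] subspace_neg[OF subspace_V]
      by (simp add: equivariant_def linear_on_def frobenius_minus)
  qed
  have mult_closed: "compose ?V f g \<in> equivariant_maps"
    if f: "f \<in> equivariant_maps" and g: "g \<in> equivariant_maps" for f g
    unfolding compose_def
  proof (rule restrict_equivariant_maps)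
    show "equivariant ?V (\<lambda>x. f (g x))"
      using linear_on_comp[OF maps(1)[OF g] maps(1)[OF f]] maps(3)[OF f] maps(3)[OF g]
        linear_onD(1)[OF maps(1)[OF g]]
      by (simp add: equivariant_def)
  qed
  have zero_closed: "(\<lambda>x\<in>?V. 0) \<in> equivariant_maps"
    by (rule restrict_equivariant_maps)
      (simp add: equivariant_def linear_on_def subspace_0[OF subspace_V] power_0_left)
  have inv_R: "inv\<^bsub>add_monoid R\<^esub> f = (\<lambda>x\<in>?V. - f x)" if f: "f \<in> equivariant_maps" for f
  proof (rule m_inv_eqI)
    show "g = (\<lambda>x\<in>?V. - f x)"
      if g: "g \<in> carrier (add_monoid R)" and e: "f \<otimes>\<^bsub>add_monoid R\<^esub> g = \<one>\<^bsub>add_monoid R\<^esub>" for g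
    proof (rule extensionalityI[of _ ?V])
      show "g \<in> extensional ?V" using g maps(2) by (simp add: carrier_R)
      fix x assume x: "x \<in> ?V"
      then have "f x + g x = 0" using fun_cong[OF e, of x] by (simp add: ops)
      then show "g x = (\<lambda>x\<in>?V. - f x) x" using x by (simp add: add_eq_0_iff)
    qed simp
  qed (auto simp: carrier_R ops minus_closed[OF f] intro!: restrict_ext)
  show "left_ideal (annihilator R M W) R" if W: "submodule W R0 (evaluation_module M)"
    unfolding left_ideal_def
  proof (intro conjI ballI additive_subgroup.intro subgroup.intro)
    fix f g assume "f \<in> carrier R" "g \<in> annihilator R M W"
    then show "f \<otimes>\<^bsub>R\<^esub> g \<in> annihilator R M W"
      using mult_closed W_V[OF W] linear_on_zero[OF maps(1) subspace_V]
      by (simp add: annihilator carrier_R ops compose_eq)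
  next
    fix f assume f: "f \<in> annihilator R M W"
    then have fR: "f \<in> equivariant_maps" by (simp add: annihilator)
    show "inv\<^bsub>add_monoid R\<^esub> f \<in> annihilator R M W"
      unfolding inv_R[OF fR] using f W_V[OF W] minus_closed[OF fR] by (simp add: annihilator)
  qed (use W_V[OF W] in \<open>auto simp: annihilator carrier_R ops add_closed zero_closed\<close>)
qed

end

theorem theorem4p2:
  fixes n m r :: nat
    and \<pp>0 \<pp> :: "'k::finite_field poly"
    and t :: "'k alg_closure"
    and \<phi> :: "'k poly \<Rightarrow> 'k alg_closure poly"
    and \<kappa> :: "'k poly set ring"
    and M :: "('k poly set, 'k alg_closure) module"
    and E R0 R :: "('k alg_closure \<Rightarrow> 'k alg_closure) ring"
    and \<pi> :: "'k alg_closure poly"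
  assumes "n \<ge> 1"
    and "Polynomial.lead_coeff \<pp>0 = 1" and "Factorial_Ring.irreducible \<pp>0" and "Polynomial.degree \<pp>0 = r"
    and "coprime n r"
    and "t \<in> Fq_ext r" and "poly (map_poly to_ac \<pp>0) t = 0"
    and "Fq_algebra_hom r \<phi>" and "\<phi> [:0, 1:] = [:t:] + Polynomial.monom 1 n"
    and "Polynomial.lead_coeff \<pp> = 1" and "Factorial_Ring.irreducible \<pp>" and "\<pp> \<noteq> \<pp>0"
    and "m dvd n"
    and "\<kappa> = residue_field \<pp>"
    and "M = torsion_module \<phi> \<pp>"
    and "\<pi> = Polynomial.monom 1 r"
    and "E = End_ring \<kappa> M"
    and "R0 = adjoin_op \<kappa> M
              (\<lambda>v\<in>carrier M. twisted_apply (\<pi> [^]\<^bsub>twisted_ring r\<^esub> m) v)"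
    and "R = centralizer E (carrier R0)"
  shows "bij_betw (zero_locus M)
           {C. left_ideal C R} {W. submodule W R0 (evaluation_module M)} \<and>
         bij_betw (annihilator R M)
           {W. submodule W R0 (evaluation_module M)} {C. left_ideal C R} \<and>
         (\<forall>C. left_ideal C R \<longrightarrow> annihilator R M (zero_locus M C) = C) \<and>
         (\<forall>W. submodule W R0 (evaluation_module M) \<longrightarrow> zero_locus M (annihilator R M W) = W)"
proof -
  interpret drinfeld_module \<phi> n r t
    using assms(1,8,9) by unfold_locales simp_all
  have "action \<pp>0 x = x ^ (CARD('k) ^ (n * r))" for x
    by (rule action_characteristic[OF assms(2,3,4,5,6,7)])
  then have "relative_trace_module action (torsion \<phi> \<pp>) (\<lambda>x. x ^ (CARD('k) ^ (r * m))) (n div m)"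
    by (rule relative_trace_module_torsion[OF assms(11) _ assms(5,13)])
  note bij = torsion_bijections[OF this, folded assms(14,15,16), folded assms(17,18,19)]
  have "bij_betw (zero_locus M) {C. left_ideal C R} {W. submodule W R0 (evaluation_module M)}"
    by (rule bij_betw_byWitness[where f' = "annihilator R M"]) (use bij in auto)
  moreover have "bij_betw (annihilator R M)
      {W. submodule W R0 (evaluation_module M)} {C. left_ideal C R}"
    by (rule bij_betw_byWitness[where f' = "zero_locus M"]) (use bij in auto)
  ultimately show ?thesis using bij by blast
qed

end
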